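(* Let $M=\{1^{k},2^{k},\ldots,n^{k}\}$ with $k\geq 1$. For all integers $g,\ell\geq 1$ and $1\leq h\leq g+\ell$, the pair $(g\mathsf{exc}_\ell,g\mathsf{den}_h)$ is $r$-Euler-Mahonian over $\mathfrak{S}_M$, that is, $$\sum_{w\in\mathfrak{S}_M}t^{r\mathsf{des}(w)}q^{r\mathsf{maj}(w)}=\sum_{w\in\mathfrak{S}_M}t^{g\mathsf{exc}_\ell(w)}q^{g\mathsf{den}_h(w)},$$ where $r=g+\ell-1$.
   Context: $i^{k}$ denotes $k$ occurrences of $i$; $m=kn$; $\mathfrak{S}_M$ is the set of all multipermutations (rearrangements, as words of length $m$) of $M$. Let $w=\alpha_1\alpha_2\ldots\alpha_m\in\mathfrak{S}_M$, and let $\bar w=x_1x_2\ldots x_m$ be its weakly increasing rearrangement. In the notations below the prefixes $g$, $r$ and the subscripts are integer parameters $\geq 1$ (not multiplication). For any word, $\mathsf{inv}$ is the number of pairs of positions $i<j$ whose letters satisfy (letter at $i$) $>$ (letter at $j$), and $\mathsf{imv}$ is the number of pairs $i<j$ with (letter at $i$) $\geq$ (letter at $j$). $r$-descent number and $r$-major index: $r\mathsf{Des}(w)=\{i\in[m-1]\mid \alpha_i\geq\alpha_{i+1}+r\}$, $r\mathsf{des}(w)=|r\mathsf{Des}(w)|$, and $r\mathsf{maj}(w)=\sum_{i\in r\mathsf{Des}(w)}i+|\{(i,j)\mid i<j,\ \alpha_j<\alpha_i<\alpha_j+r\}|$. $g$-gap $\ell$-level excedance number: $g\mathsf{exc}_\ell(w)=|\{i\in[m]\mid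 \alpha_i\geq x_i+g,\ x_i\geq\ell\}|$. $g$-gap $h$-level excedance places: $g\mathsf{Excp}_h(w)=\{i\in[m]\mid \alpha_i\geq x_i+g,\ \alpha_i\geq h\}$. Let $g\mathsf{Exc}_h(w)$ (resp. $g\mathsf{Nexc}_h(w)$) be the subword of $w$ formed by the letters at positions in (resp. not in) $g\mathsf{Excp}_h(w)$, in order. The $g$-gap $h$-level Denert's statistic is $$g\mathsf{den}_h(w)=\sum_{i\in g\mathsf{Excp}_h(w)}(i+B^g_i(w))+\mathsf{imv}(g\mathsf{Exc}_h(w))+\mathsf{inv}(g\mathsf{Nexc}_h(w)),\qquad B^g_i(w)=|\{j\mid \alpha_i-g<x_j<\alpha_i\}|.$$ *)

theory Defs
  imports "HOL-Combinatorics.Multiset_Permutations" "HOL-Computational_Algebra.Polynomial"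
begin

text \<open>
  Words are lists of natural numbers. All positions are counted from 1, so the statistics
  access letters through \<open>letter\<close>, and \<open>letter w i\<close> is meaningful for \<open>1 \<le> i \<le> length w\<close>.
\<close>

definition letter :: "nat list \<Rightarrow> nat \<Rightarrow> nat" where
  "letter w i = w ! (i - 1)"

definition positions :: "nat list \<Rightarrow> nat set" where
  "positions w = {1..length w}"

definition sorted_letter :: "nat list \<Rightarrow> nat \<Rightarrow> nat" where
  "sorted_letter w i = letter (sort w) i"

text \<open>The positions used by \<^const>\<open>nths\<close> are counted from 0.\<close>

definition subword :: "nat list \<Rightarrow> nat set \<Rightarrow> nat list" where
  "subword w A = nths w {i. Suc i \<in> A}"

definition regular_multiset :: "nat \<Rightarrow> nat \<Rightarrow> nat multiset" where
  "regular_multiset k n = (\<Sum>i\<in>{1..n}. replicate_mset k i)"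

definition word_inv :: "nat list \<Rightarrow> nat" where
  "word_inv w = card {(i, j). i \<in> positions w \<and> j \<in> positions w \<and> i < j \<and> letter w i > letter w j}"

definition word_imv :: "nat list \<Rightarrow> nat" where
  "word_imv w = card {(i, j). i \<in> positions w \<and> j \<in> positions w \<and> i < j \<and> letter w i \<ge> letter w j}"

definition rDes :: "nat \<Rightarrow> nat list \<Rightarrow> nat set" where
  "rDes r w = {i \<in> {1..length w - 1}. letter w i \<ge> letter w (i + 1) + r}"

definition rdes :: "nat \<Rightarrow> nat list \<Rightarrow> nat" where
  "rdes r w = card (rDes r w)"

definition rmaj :: "nat \<Rightarrow> nat list \<Rightarrow> nat" where
  "rmaj r w = (\<Sum>i\<in>rDes r w. i) +
     card {(i, j). i \<in> positions w \<and> j \<in> positions w \<and> i < j \<and>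
                   letter w j < letter w i \<and> letter w i < letter w j + r}"

definition gexc :: "nat \<Rightarrow> nat \<Rightarrow> nat list \<Rightarrow> nat" where
  "gexc g l w =
     card {i \<in> positions w. letter w i \<ge> sorted_letter w i + g \<and> sorted_letter w i \<ge> l}"

definition gExcp :: "nat \<Rightarrow> nat \<Rightarrow> nat list \<Rightarrow> nat set" where
  "gExcp g h w = {i \<in> positions w. letter w i \<ge> sorted_letter w i + g \<and> letter w i \<ge> h}"

definition gExc :: "nat \<Rightarrow> nat \<Rightarrow> nat list \<Rightarrow> nat list" where
  "gExc g h w = subword w (gExcp g h w)"

definition gNexc :: "nat \<Rightarrow> nat \<Rightarrow> nat list \<Rightarrow> nat list" where
  "gNexc g h w = subword w (- gExcp g h w)"

text \<open>
  The lower bound \<open>\<alpha>\<^sub>i - g < x\<^sub>j\<close> is written additively, as subtraction on \<^typ>\<open>nat\<close> truncates.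
\<close>

definition gB :: "nat \<Rightarrow> nat list \<Rightarrow> nat \<Rightarrow> nat" where
  "gB g w i =
     card {j \<in> positions w. letter w i < sorted_letter w j + g \<and> sorted_letter w j < letter w i}"

definition gden :: "nat \<Rightarrow> nat \<Rightarrow> nat list \<Rightarrow> nat" where
  "gden g h w =
     (\<Sum>i\<in>gExcp g h w. i + gB g w i) + word_imv (gExc g h w) + word_inv (gNexc g h w)"

text \<open>
  Bivariate generating polynomials are elements of \<open>(\<int>[q])[t]\<close>: the outer indeterminate is
  \<open>t\<close>, the inner one is \<open>q\<close>, and \<open>tq_monom a b\<close> is \<open>t\<^sup>a q\<^sup>b\<close>.
\<close>

definition tq_monom :: "nat \<Rightarrow> nat \<Rightarrow> int poly poly" where
  "tq_monom a b = monom (monom 1 b) a"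

definition r_Euler_Mahonian ::
  "nat \<Rightarrow> nat list set \<Rightarrow> (nat list \<Rightarrow> nat) \<Rightarrow> (nat list \<Rightarrow> nat) \<Rightarrow> bool" where
  "r_Euler_Mahonian r S stat1 stat2 \<longleftrightarrow>
     (\<Sum>w\<in>S. tq_monom (rdes r w) (rmaj r w)) = (\<Sum>w\<in>S. tq_monom (stat1 w) (stat2 w))"

end

theory Submission
  imports Defs
begin

text \<open>
  Both pairs of statistics obey the same recursion in the multiset of letters, and this recursion
  determines their joint distribution. Let \<open>n\<close> be at least as large as all letters of \<open>M\<close>. A
  word over \<open>M + {n}\<close> with a marked occurrence of \<open>n\<close> is obtained from a word over \<open>M\<close> by
  inserting \<open>n\<close> at one of the \<open>size M + 1\<close> slots. If the mark carries the weight
  \<open>q\<close> to the number of occurrences of \<open>n\<close> on its right, then the choice of the mark amounts to a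
  \<open>q\<close>-integer. The slots can be numbered \<open>0, \<dots>, size M\<close> such that slot \<open>c\<close> raises the second
  statistic (including the weight) by exactly \<open>c\<close>, and raises the first one, by 1, unless
  \<open>c \<le> s + d\<close>. Here \<open>s\<close> is the value of the first statistic on the shorter word and \<open>d\<close> a
  number of letters of \<open>M\<close>; this is \<open>insertion_law\<close>.

  For \<open>(rdes, rmaj)\<close> the letter is simply inserted into the word (\<open>insertion_law_rmaj\<close>); the
  number \<open>d\<close> counts the letters above \<open>n - r\<close>.

  For \<open>(gexc, gden)\<close> the letters stand in columns headed by the sorted word, and one more column
  headed by \<open>n\<close> is added on the right. The new letter \<open>n\<close> is put into any column, and the letter
  that it displaces is bumped to the right: in each column, the carried letter is exchanged with
  the letter found there if both would be excedances or both would be non-excedances in this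
  column, and passes by otherwise. The last carried letter fills the new column. This process is
  reversible and changes the type of no column but possibly the one that receives \<open>n\<close>.
  Denert's statistic, with a suitable weight for the carried letter, is invariant along the scan
  (\<open>denert_bump\<close>), so the gain can be read off where \<open>n\<close> was placed
  (\<open>insertion_law_gden\<close>). Here \<open>d\<close> counts the letters \<open>x\<close> with \<open>x < l\<close> or \<open>x > n - g\<close>.

  When all smaller letters occur \<open>k\<close> times, the two values of \<open>d\<close> agree for \<open>r = g + l - 1\<close>
  (\<open>preserving_letters_eq\<close>), and the letters can be inserted one after the other, in weakly
  increasing order.
\<close>

section \<open>Equidistribution and generating polynomials\<close>

lemma tq_monom_mult: "tq_monom a b * tq_monom c d = tq_monom (a + c) (b + d)"
  by (simp add: tq_monom_def mult_monom)

lemma coeff_tq_monom: "coeff (coeff (tq_monom a b) i) j = (if (a, b) = (i, j) then 1 else 0)"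
  by (auto simp: tq_monom_def)

text \<open>
  The coefficients of the generating polynomial are the sizes of the fibres of the pair of
  statistics, and a sum over \<open>S\<close> of a function of the pair depends only on these sizes.
\<close>

lemma generating_polynomial_determines_sums:
  fixes F :: "nat \<Rightarrow> nat \<Rightarrow> 'c::comm_monoid_add"
  assumes "finite S"
    and eq: "(\<Sum>w\<in>S. tq_monom (a w) (b w)) = (\<Sum>w\<in>S. tq_monom (a' w) (b' w))"
  shows "(\<Sum>w\<in>S. F (a w) (b w)) = (\<Sum>w\<in>S. F (a' w) (b' w))"
proof -
  have count: "int (count (image_mset (\<lambda>w. (f w, f' w)) (mset_set S)) (i, j))
      = coeff (coeff (\<Sum>w\<in>S. tq_monom (f w) (f' w)) i) j" for f f' :: "'a \<Rightarrow> nat" and i j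
    using \<open>finite S\<close>
    by (induction S) (auto simp: coeff_tq_monom)
  have "image_mset (\<lambda>w. (a w, b w)) (mset_set S) = image_mset (\<lambda>w. (a' w, b' w)) (mset_set S)"
    (is "?A = ?B")
  proof (rule multiset_eqI)
    fix x :: "nat \<times> nat"
    obtain i j where x: "x = (i, j)" by (cases x)
    have "int (count ?A x) = int (count ?B x)"
      unfolding x count eq ..
    then show "count ?A x = count ?B x" by simp
  qed
  then have "sum_mset (image_mset (case_prod F) ?A) = sum_mset (image_mset (case_prod F) ?B)"
    by simp
  then show ?thesis
    by (simp add: sum_unfold_sum_mset image_mset.compositionality comp_def)
qed

definition q_int :: "nat \<Rightarrow> int poly poly" where
  "q_int j = (\<Sum>i<j. tq_monom 0 i)"

lemma q_int_nonzero:
  assumes "j > 0"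
  shows "q_int j \<noteq> 0"
proof -
  have "coeff (coeff (q_int j) 0) 0 = (\<Sum>i<j. if i = 0 then 1 else 0)"
    by (simp add: q_int_def coeff_sum coeff_tq_monom)
  also have "\<dots> = 1"
    using assms by (simp add: sum.delta)
  finally show ?thesis by auto
qed

text \<open>
  Weighting each occurrence of \<open>n\<close> by the number of occurrences to its right turns the choice
  of an occurrence into the factor \<^const>\<open>q_int\<close>. Words with equal letters can thus be built
  by inserting one letter at a time, although several insertions give the same word.
\<close>

lemma sum_over_occurrences:
  fixes f :: "nat \<Rightarrow> 'c::comm_monoid_add"
  shows "(\<Sum>y | y < length w \<and> w ! y = n. f (count_list (drop (Suc y) w) n))
    = (\<Sum>i<count_list w n. f i)"
proof (induction w)
  case (Cons a w)
  have "{y. y < length (a # w) \<and> (a # w) ! y = n}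
      = (if a = n then {0} else {}) \<union> Suc ` {y. y < length w \<and> w ! y = n}"
    by (auto simp: image_iff less_Suc_eq_0_disj)
  then have "(\<Sum>y | y < length (a # w) \<and> (a # w) ! y = n. f (count_list (drop (Suc y) (a # w)) n))
      = (if a = n then f (count_list w n) else 0)
        + (\<Sum>y | y < length w \<and> w ! y = n. f (count_list (drop (Suc y) w) n))"
    by (simp add: sum.union_disjoint sum.reindex)
  then show ?case
    by (auto simp: Cons.IH add.commute)
qed simp

section \<open>Labelling the insertion slots\<close>

text \<open>
  The slots \<open>0, \<dots>, p - 1\<close> split into those where an insertion preserves the first statistic
  (\<open>Q\<close>) and the others. Preserving slots are numbered from right to left starting with 0; the
  remaining ones continue from left to right: for a slot \<open>y\<close> outside \<open>Q\<close>, the number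
  \<open>y\<close> already counts all slots on its left, and the cardinality adds the preserving ones on
  its right.
\<close>

definition slot_label :: "(nat \<Rightarrow> bool) \<Rightarrow> nat \<Rightarrow> nat \<Rightarrow> nat" where
  "slot_label Q p y = (if Q y then 0 else y) + card {j. y < j \<and> j < p \<and> Q j}"

lemma slot_label_Suc:
  assumes "y < p"
  shows "slot_label Q (Suc p) y = slot_label Q p y + (if Q p then 1 else 0)"
proof -
  have "{j. y < j \<and> j < Suc p \<and> Q j} = {j. y < j \<and> j < p \<and> Q j} \<union> (if Q p then {p} else {})"
    using assms by (auto simp: less_Suc_eq)
  then show ?thesis by (simp add: slot_label_def)
qed

lemma slot_label_last: "slot_label Q (Suc p) p = (if Q p then 0 else p)"
proof -
  have none: "{j. p < j \<and> j < Suc p \<and> Q j} = {}" by auto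
  show ?thesis unfolding slot_label_def none by simp
qed

text \<open>
  A new last slot either receives the label 0 and shifts all others by one, or receives the
  largest label and leaves the others alone.
\<close>

lemma image_slot_label: "slot_label Q p ` {..<p} = {..<p}"
proof (induction p)
  case (Suc p)
  have "slot_label Q (Suc p) ` {..<Suc p}
      = insert (if Q p then 0 else p) ((\<lambda>c. c + (if Q p then 1 else 0)) ` slot_label Q p ` {..<p})"
    by (auto simp: lessThan_Suc slot_label_last slot_label_Suc image_iff)
  also have "\<dots> = {..<Suc p}"
    unfolding Suc.IH using lessThan_Suc_eq_insert_0[of p] by (cases "Q p") (simp_all add: lessThan_Suc)
  finally show ?case .
qed simp

lemma bij_betw_slot_label: "bij_betw (slot_label Q p) {..<p} {..<p}"
  using eq_card_imp_inj_on[of "{..<p}" "slot_label Q p"] image_slot_label[of Q p]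
  by (simp add: bij_betw_def)

text \<open>
  The slots outside \<open>Q\<close> are numbered from left to right. Hence, if an initial segment \<open>low\<close> of
  the slots is declared preserving as well, the preserving slots are still exactly those with
  the smallest labels.
\<close>

lemma slot_label_less_card_iff:
  assumes low: "\<And>i j. j < i \<Longrightarrow> i < p \<Longrightarrow> low i \<Longrightarrow> low j"
    and "y < p"
  shows "slot_label Q p y < card {j. j < p \<and> (Q j \<or> low j)} \<longleftrightarrow> Q y \<or> low y"
  using assms
proof (induction p)
  case (Suc p)
  let ?C = "\<lambda>p. {j. j < p \<and> (Q j \<or> low j)}"
  have C: "?C (Suc p) = ?C p \<union> (if Q p \<or> low p then {p} else {})"
    by (auto simp: less_Suc_eq)
  have card_C: "card (?C (Suc p)) = card (?C p) + (if Q p \<or> low p then 1 else 0)"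
    unfolding C by (auto simp: card_insert_if)
  have IH: "slot_label Q p y < card (?C p) \<longleftrightarrow> Q y \<or> low y" if "y < p"
    by (rule Suc.IH) (use Suc.prems that in auto)
  show ?case
  proof (cases "low p \<and> \<not> Q p")
    case True
    have "\<forall>j\<le>p. low j"
      using Suc.prems(1)[of _ p] True by (auto simp: le_less)
    moreover have "?C (Suc p) = {..<Suc p}"
      using \<open>\<forall>j\<le>p. low j\<close> by auto
    moreover have "slot_label Q (Suc p) y < Suc p"
      using image_slot_label[of Q "Suc p"] Suc.prems(2) by blast
    ultimately show ?thesis
      using Suc.prems(2) by auto
  next
    case False
    have "card (?C p) \<le> p"
      using card_mono[of "{..<p}" "?C p"] by auto
    then show ?thesis
      using False IH Suc.prems(2) unfolding card_C
      by (cases "y = p") (auto simp: slot_label_last slot_label_Suc less_Suc_eq)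
  qed
qed simp

lemma card_slots_from:
  assumes "y \<le> length w"
  shows "card {j. y \<le> j \<and> j < length w \<and> T (w ! j)} = length (filter T (drop y w))"
proof -
  have "{j. y \<le> j \<and> j < length w \<and> T (w ! j)}
      = (\<lambda>i. y + i) ` {i. i < length (drop y w) \<and> T (drop y w ! i)}" (is "?A = ?f ` ?B")
  proof (rule set_eqI)
    fix j show "j \<in> ?A \<longleftrightarrow> j \<in> ?f ` ?B"
      using assms by (cases "y \<le> j") (auto simp: image_iff le_iff_add)
  qed
  then show ?thesis
    by (simp add: card_image length_filter_conv_card)
qed

section \<open>The insertion law\<close>

text \<open>
  The number \<open>d\<close> is the only parameter in which the recursion depends on the statistics: of the
  \<open>size M + 1\<close> labels, the \<open>a w + d + 1\<close> smallest ones preserve \<open>a\<close>.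
\<close>

definition insertion_law ::
  "(nat list \<Rightarrow> nat) \<Rightarrow> (nat list \<Rightarrow> nat) \<Rightarrow> nat multiset \<Rightarrow> nat \<Rightarrow> nat \<Rightarrow> bool" where
  "insertion_law a b M n d \<longleftrightarrow>
     (\<Sum>w\<in>permutations_of_multiset (add_mset n M). tq_monom (a w) (b w)) * q_int (Suc (count M n))
     = (\<Sum>w\<in>permutations_of_multiset M. \<Sum>c<Suc (size M).
          tq_monom (a w + (if c < Suc (a w + d) then 0 else 1)) (b w + c))"

text \<open>
  Both sides count pairs of a word \<open>w\<close> and a slot \<open>y\<close>, the left-hand side through the longer
  word \<open>\<phi> y w\<close> with its marked occurrence of \<open>n\<close> at \<open>y\<close>. The label of the slot is what the
  second statistic gains, with the weight of the mark included.
\<close>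

lemma insertion_lawI:
  assumes bij: "\<And>y. y < Suc (size M) \<Longrightarrow> bij_betw (\<phi> y) (permutations_of_multiset M)
        {w \<in> permutations_of_multiset (add_mset n M). w ! y = n}"
    and a: "\<And>w y. mset w = M \<Longrightarrow> y < Suc (size M) \<Longrightarrow>
        a (\<phi> y w) = a w + (if Q w y \<or> low y then 0 else 1)"
    and b: "\<And>w y. mset w = M \<Longrightarrow> y < Suc (size M) \<Longrightarrow>
        b (\<phi> y w) + count_list (drop (Suc y) (\<phi> y w)) n = b w + slot_label (Q w) (Suc (size M)) y"
    and low: "\<And>i j. j < i \<Longrightarrow> i < Suc (size M) \<Longrightarrow> low i \<Longrightarrow> low j"
    and card: "\<And>w. mset w = M \<Longrightarrow> card {y. y < Suc (size M) \<and> (Q w y \<or> low y)} = Suc (a w + d)"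
  shows "insertion_law a b M n d"
proof -
  let ?S = "permutations_of_multiset M" and ?S' = "permutations_of_multiset (add_mset n M)"
  let ?p = "Suc (size M)"
  define G where "G w y = tq_monom (a w) (b w + count_list (drop (Suc y) w) n)" for w y
  have "(\<Sum>w\<in>?S'. tq_monom (a w) (b w)) * q_int (Suc (count M n))
      = (\<Sum>w\<in>?S'. \<Sum>y | y < ?p \<and> w ! y = n. G w y)"
    unfolding sum_distrib_right
  proof (rule sum.cong[OF refl])
    fix w assume "w \<in> ?S'"
    then have w: "mset w = add_mset n M"
      by (simp add: permutations_of_multiset_def)
    have len: "length w = ?p"
      using w by (metis size_add_mset size_mset)
    have cnt: "count_list w n = Suc (count M n)"
      using w by (metis count_add_mset count_mset)
    have "tq_monom (a w) (b w) * q_int (Suc (count M n))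
        = (\<Sum>i<count_list w n. tq_monom (a w) (b w + i))"
      by (simp only: q_int_def cnt sum_distrib_left tq_monom_mult add_0_right)
    also have "\<dots> = (\<Sum>y | y < ?p \<and> w ! y = n. G w y)"
      unfolding G_def len[symmetric] by (rule sum_over_occurrences[symmetric])
    finally show "tq_monom (a w) (b w) * q_int (Suc (count M n))
        = (\<Sum>y | y < ?p \<and> w ! y = n. G w y)" .
  qed
  also have "\<dots> = (\<Sum>w\<in>?S'. \<Sum>y\<in>{..<?p}. if w ! y = n then G w y else 0)"
    by (rule sum.cong[OF refl]) (simp add: sum.inter_filter[symmetric] del: sum.lessThan_Suc)
  also have "\<dots> = (\<Sum>y\<in>{..<?p}. \<Sum>w\<in>?S'. if w ! y = n then G w y else 0)"
    by (rule sum.swap)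
  also have "\<dots> = (\<Sum>y\<in>{..<?p}. \<Sum>w\<in>?S. G (\<phi> y w) y)"
  proof (rule sum.cong[OF refl])
    fix y assume "y \<in> {..<?p}"
    then have "bij_betw (\<phi> y) ?S {w \<in> ?S'. w ! y = n}" using bij by simp
    then have "(\<Sum>w\<in>?S. G (\<phi> y w) y) = (\<Sum>w\<in>{w \<in> ?S'. w ! y = n}. G w y)"
      by (rule sum.reindex_bij_betw)
    also have "\<dots> = (\<Sum>w\<in>?S'. if w ! y = n then G w y else 0)"
      by (rule sum.inter_filter) simp
    finally show "(\<Sum>w\<in>?S'. if w ! y = n then G w y else 0) = (\<Sum>w\<in>?S. G (\<phi> y w) y)" ..
  qed
  also have "\<dots> = (\<Sum>w\<in>?S. \<Sum>y\<in>{..<?p}. G (\<phi> y w) y)"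
    by (rule sum.swap)
  also have "\<dots> = (\<Sum>w\<in>?S. \<Sum>c<?p. tq_monom (a w + (if c < Suc (a w + d) then 0 else 1)) (b w + c))"
  proof (rule sum.cong[OF refl])
    fix w assume "w \<in> ?S"
    then have w: "mset w = M" by (simp add: permutations_of_multiset_def)
    let ?h = "\<lambda>c. tq_monom (a w + (if c < Suc (a w + d) then 0 else 1)) (b w + c)"
    have "G (\<phi> y w) y = ?h (slot_label (Q w) ?p y)" if "y < ?p" for y
    proof -
      have "slot_label (Q w) ?p y < card {j. j < ?p \<and> (Q w j \<or> low j)} \<longleftrightarrow> Q w y \<or> low y"
        by (rule slot_label_less_card_iff) (use low that in blast)+
      then show ?thesis
        using a[OF w that] b[OF w that] by (simp add: G_def card[OF w])
    qed
    then have "(\<Sum>y\<in>{..<?p}. G (\<phi> y w) y) = (\<Sum>y\<in>{..<?p}. ?h (slot_label (Q w) ?p y))"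
      by (intro sum.cong) auto
    also have "\<dots> = (\<Sum>c<?p. ?h c)"
      by (rule sum.reindex_bij_betw[OF bij_betw_slot_label])
    finally show "(\<Sum>y\<in>{..<?p}. G (\<phi> y w) y) = (\<Sum>c<?p. ?h c)" .
  qed
  finally show ?thesis unfolding insertion_law_def .
qed

text \<open>
  By the insertion law the distribution over \<open>M\<close> determines that over \<open>M + {n}\<close>, up to a
  nonzero factor that cancels in the integral domain \<open>\<int>[q][t]\<close>.
\<close>

lemma equidistribution_step:
  assumes eq: "(\<Sum>w\<in>permutations_of_multiset M. tq_monom (a w) (b w))
      = (\<Sum>w\<in>permutations_of_multiset M. tq_monom (a' w) (b' w))"
    and law: "insertion_law a b M n d" and law': "insertion_law a' b' M n d"
  shows "(\<Sum>w\<in>permutations_of_multiset (add_mset n M). tq_monom (a w) (b w))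
      = (\<Sum>w\<in>permutations_of_multiset (add_mset n M). tq_monom (a' w) (b' w))"
proof -
  let ?F = "\<lambda>a b. \<Sum>c<Suc (size M). tq_monom (a + (if c < Suc (a + d) then 0 else 1)) (b + c)"
  have "(\<Sum>w\<in>permutations_of_multiset M. ?F (a w) (b w))
      = (\<Sum>w\<in>permutations_of_multiset M. ?F (a' w) (b' w))"
    by (rule generating_polynomial_determines_sums[OF _ eq]) simp
  then have "(\<Sum>w\<in>permutations_of_multiset (add_mset n M). tq_monom (a w) (b w)) * q_int (Suc (count M n))
      = (\<Sum>w\<in>permutations_of_multiset (add_mset n M). tq_monom (a' w) (b' w)) * q_int (Suc (count M n))"
    using law law' by (simp only: insertion_law_def)
  then show ?thesis
    using q_int_nonzero[of "Suc (count M n)"] by simp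
qed

lemma bij_betw_insert_letter:
  fixes n :: nat
  assumes "y < Suc (size M)"
  shows "bij_betw (\<lambda>w. take y w @ n # drop y w) (permutations_of_multiset M)
    {w \<in> permutations_of_multiset (add_mset n M). w ! y = n}"
proof (rule bij_betw_byWitness[where f' = "\<lambda>w. take y w @ drop (Suc y) w"])
  have len: "length w = size (mset w)" for w :: "nat list" by simp
  have split: "w = take y w @ w ! y # drop (Suc y) w" if "mset w = add_mset n M" for w
    by (rule id_take_nth_drop) (use that assms len[of w] in auto)
  show "\<forall>w\<in>permutations_of_multiset M.
      take y (take y w @ n # drop y w) @ drop (Suc y) (take y w @ n # drop y w) = w"
    using assms by (auto simp: permutations_of_multiset_def min_def)
  show "\<forall>w\<in>{w \<in> permutations_of_multiset (add_mset n M). w ! y = n}.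
      take y (take y w @ drop (Suc y) w) @ n # drop y (take y w @ drop (Suc y) w) = w"
  proof safe
    fix w assume "w \<in> permutations_of_multiset (add_mset (w ! y) M)"
    then have w: "mset w = add_mset (w ! y) M" by (simp add: permutations_of_multiset_def)
    then have "y < length w" using len[of w] assms by simp
    then show "take y (take y w @ drop (Suc y) w) @ w ! y # drop y (take y w @ drop (Suc y) w) = w"
      by (simp add: min_def id_take_nth_drop[symmetric])
  qed
  show "(\<lambda>w. take y w @ n # drop y w) ` permutations_of_multiset M
      \<subseteq> {w \<in> permutations_of_multiset (add_mset n M). w ! y = n}"
  proof safe
    fix w assume "w \<in> permutations_of_multiset M"
    then have w: "mset w = M" by (simp add: permutations_of_multiset_def)
    then show "take y w @ n # drop y w \<in> permutations_of_multiset (add_mset n M)"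
      by (metis append_take_drop_id mset.simps(2) mset_append permutations_of_multisetI
          union_mset_add_mset_right)
    show "(take y w @ n # drop y w) ! y = n"
      using assms len[of w] w by (simp add: nth_append)
  qed
  show "(\<lambda>w. take y w @ drop (Suc y) w) ` {w \<in> permutations_of_multiset (add_mset n M). w ! y = n}
      \<subseteq> permutations_of_multiset M"
  proof safe
    fix w assume "w \<in> permutations_of_multiset (add_mset (w ! y) M)"
    then have w: "mset w = add_mset (w ! y) M" by (simp add: permutations_of_multiset_def)
    then have "y < length w" using len[of w] assms by simp
    then have "mset (take y w @ drop (Suc y) w) + {#w ! y#} = mset w"
      by (metis add_mset_add_single id_take_nth_drop mset.simps(2) mset_append union_mset_add_mset_right)
    then show "take y w @ drop (Suc y) w \<in> permutations_of_multiset M"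
      using w by (simp add: permutations_of_multiset_def)
  qed
qed

section \<open>Counting related pairs of letters\<close>

fun related_pairs :: "(nat \<Rightarrow> nat \<Rightarrow> bool) \<Rightarrow> nat list \<Rightarrow> nat" where
  "related_pairs R [] = 0"
| "related_pairs R (a # w) = length (filter (R a) w) + related_pairs R w"

lemma card_related_pairs:
  "card {(i, j). i \<in> positions w \<and> j \<in> positions w \<and> i < j \<and> R (letter w i) (letter w j)}
    = related_pairs R w"
proof -
  have "card {(i, j). i < j \<and> j < length w \<and> R (w ! i) (w ! j)} = related_pairs R w"
  proof (induction w)
    case (Cons a w)
    let ?S = "\<lambda>w. {(i, j). i < j \<and> j < length w \<and> R (w ! i) (w ! j)}"
    have "?S (a # w) = (\<lambda>j. (0, Suc j)) ` {j. j < length w \<and> R a (w ! j)} \<union> map_prod Suc Suc ` ?S w"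
      (is "_ = ?A \<union> ?B")
    proof (rule set_eqI, clarify)
      fix i j
      show "(i, j) \<in> ?S (a # w) \<longleftrightarrow> (i, j) \<in> ?A \<union> ?B"
        by (cases i; cases j) (auto simp: image_iff)
    qed
    moreover have "finite (?S w)"
      by (rule finite_subset[of _ "{..<length w} \<times> {..<length w}"]) auto
    moreover have "?A \<inter> ?B = {}" by auto
    ultimately have "card (?S (a # w)) = card ?A + card ?B"
      by (simp add: card_Un_disjoint)
    also have "card ?A = length (filter (R a) w)"
      by (subst card_image) (auto simp: inj_on_def length_filter_conv_card)
    also have "card ?B = related_pairs R w"
      unfolding Cons.IH[symmetric] by (subst card_image) (auto simp: inj_on_def)
    finally show ?case by simp
  qed simp
  moreover have "{(i, j). i \<in> positions w \<and> j \<in> positions w \<and> i < j \<and> R (letter w i) (letter w j)}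
      = map_prod Suc Suc ` {(i, j). i < j \<and> j < length w \<and> R (w ! i) (w ! j)}" (is "?A = ?B")
  proof (rule set_eqI, clarify)
    fix i j
    show "(i, j) \<in> ?A \<longleftrightarrow> (i, j) \<in> ?B"
      by (cases i; cases j) (auto simp: image_iff positions_def letter_def)
  qed
  ultimately show ?thesis
    by (simp add: card_image inj_on_def map_prod_def)
qed

lemma related_pairs_insert:
  "related_pairs R (u @ b # v)
    = related_pairs R (u @ v) + length (filter (\<lambda>a. R a b) u) + length (filter (R b) v)"
  by (induction u) auto

section \<open>Inserting a largest letter: the r-major index\<close>

text \<open>
  A descent between the letters at the 0-based positions \<open>i - 1\<close> and \<open>i\<close> has 1-based index
  \<open>i\<close>, which is also the slot between the two letters.
\<close>

definition rDes_slots :: "nat \<Rightarrow> nat list \<Rightarrow> nat set" where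
  "rDes_slots r w = {i. 0 < i \<and> i < length w \<and> w ! (i - 1) \<ge> w ! i + r}"

lemma rDes_eq: "rDes r w = rDes_slots r w"
  by (auto simp: rDes_def rDes_slots_def letter_def)

text \<open>
  Inserting a largest letter \<open>n\<close> at the end creates no \<open>r\<close>-descent, nor does inserting it
  before a letter above \<open>n - r\<close>. At an existing \<open>r\<close>-descent the new letter takes over the
  descent, one position further to the right.
\<close>

definition keeps_rDes :: "nat \<Rightarrow> nat \<Rightarrow> nat list \<Rightarrow> nat \<Rightarrow> bool" where
  "keeps_rDes r n w y \<longleftrightarrow> y = length w \<or> y < length w \<and> (n < w ! y + r \<or> y \<in> rDes_slots r w)"

lemma rDes_insert_largest:
  assumes "1 \<le> r" and "y \<le> length w" and le: "\<forall>a\<in>set w. a \<le> n"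
  shows "rDes_slots r (take y w @ n # drop y w)
    = {i \<in> rDes_slots r w. i < y} \<union> Suc ` {i \<in> rDes_slots r w. y \<le> i}
      \<union> (if keeps_rDes r n w y then {} else {Suc y})" (is "?L = ?R")
proof (rule set_eqI)
  fix i
  have le': "w ! j \<le> n" if "j < length w" for j using le that by simp
  have nth: "(take y w @ n # drop y w) ! j = (if j < y then w ! j else if j = y then n else w ! (j - 1))"
    if "j \<le> length w" for j
    using that assms(2) by (auto simp: nth_append nth_Cons' min_def)
  have len: "length (take y w @ n # drop y w) = Suc (length w)" using assms(2) by simp
  have mem: "i \<in> ?L \<longleftrightarrow> 0 < i \<and> i \<le> length w \<and>
      (take y w @ n # drop y w) ! (i - 1) \<ge> (take y w @ n # drop y w) ! i + r"
    unfolding rDes_slots_def by (simp only: mem_Collect_eq len less_Suc_eq_le)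
  consider "i < y" | "i = y" | "i = Suc y" | k where "i = Suc k" "y < k"
    by (metis Suc_lessE linorder_neqE_nat not_less_eq)
  then show "i \<in> ?L \<longleftrightarrow> i \<in> ?R"
  proof cases
    case 1
    then show ?thesis unfolding mem using assms(2) nth[of i] nth[of "i - 1"]
      by (auto simp: rDes_slots_def)
  next
    case 2
    have "w ! (y - 1) < n + r" if "0 < y"
      using le'[of "y - 1"] that assms(1,2) by (cases y) auto
    then show ?thesis unfolding mem using 2 assms(2) nth[of y] nth[of "y - 1"]
      by (auto simp: rDes_slots_def)
  next
    case 3
    have "y \<in> rDes_slots r w \<Longrightarrow> w ! y + r \<le> n"
      using le'[of "y - 1"] by (cases y) (auto simp: rDes_slots_def)
    then show ?thesis unfolding mem using 3 assms(2) nth[of y] nth[of "Suc y"]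
      by (auto simp: keeps_rDes_def rDes_slots_def)
  next
    case 4
    then show ?thesis unfolding mem using nth[of i] nth[of "i - 1"]
      by (auto simp: rDes_slots_def image_iff)
  qed
qed

lemma finite_rDes_slots [simp]: "finite (rDes_slots r w)"
  by (rule finite_subset[of _ "{..<length w}"]) (auto simp: rDes_slots_def)

text \<open>
  Descents from the slot onwards move right by one and so contribute 1 each; a newly created
  descent contributes its position.
\<close>

lemma sum_card_rDes_insert_largest:
  assumes "1 \<le> r" and "y \<le> length w" and "\<forall>a\<in>set w. a \<le> n"
  defines "v \<equiv> take y w @ n # drop y w" and "N \<equiv> if keeps_rDes r n w y then 0 else Suc y"
  shows "card (rDes_slots r v) = card (rDes_slots r w) + (if keeps_rDes r n w y then 0 else 1)"
    and "\<Sum>(rDes_slots r v) = \<Sum>(rDes_slots r w) + card {i \<in> rDes_slots r w. y \<le> i} + N"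
proof -
  let ?A = "{i \<in> rDes_slots r w. i < y}" and ?B = "{i \<in> rDes_slots r w. y \<le> i}"
  let ?C = "if keeps_rDes r n w y then {} else {Suc y}"
  have v: "rDes_slots r v = ?A \<union> Suc ` ?B \<union> ?C"
    unfolding v_def by (rule rDes_insert_largest) (use assms in auto)
  have w: "rDes_slots r w = ?A \<union> ?B" by auto
  have disj: "(?A \<union> Suc ` ?B) \<inter> ?C = {}" "?A \<inter> Suc ` ?B = {}" "?A \<inter> ?B = {}"
    by (auto simp: keeps_rDes_def rDes_slots_def)
  have split_v: "sum f (rDes_slots r v) = sum f ?A + sum f (Suc ` ?B) + sum f ?C" for f :: "nat \<Rightarrow> nat"
    unfolding v using disj by (subst sum.union_disjoint; simp add: sum.union_disjoint)
  have split_w: "sum f (rDes_slots r w) = sum f ?A + sum f ?B" for f :: "nat \<Rightarrow> nat"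
    by (subst w, rule sum.union_disjoint) (use disj in auto)
  show "card (rDes_slots r v) = card (rDes_slots r w) + (if keeps_rDes r n w y then 0 else 1)"
    using split_v[of "\<lambda>_. 1"] split_w[of "\<lambda>_. 1"] by (simp add: card_image)
  show "\<Sum>(rDes_slots r v) = \<Sum>(rDes_slots r w) + card ?B + N"
    using split_v[of "\<lambda>i. i"] split_w[of "\<lambda>i. i"]
    by (simp add: sum.reindex sum_Suc N_def)
qed

text \<open>
  A descent bottom is at most \<open>n - r\<close>, so the descents and the letters above \<open>n - r\<close> give
  distinct slots.
\<close>

lemma card_keeps_rDes_from:
  assumes "y \<le> length w" and le: "\<forall>a\<in>set w. a \<le> n"
  shows "card {j. y \<le> j \<and> j < Suc (length w) \<and> keeps_rDes r n w j}
    = Suc (card {i \<in> rDes_slots r w. y \<le> i} + length (filter (\<lambda>a. n < a + r) (drop y w)))"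
proof -
  let ?B = "{j. y \<le> j \<and> j < length w \<and> n < w ! j + r}" and ?D = "{i \<in> rDes_slots r w. y \<le> i}"
  have "{j. y \<le> j \<and> j < Suc (length w) \<and> keeps_rDes r n w j} = insert (length w) (?D \<union> ?B)"
    using assms(1) by (auto simp: keeps_rDes_def rDes_slots_def)
  moreover have "length w \<notin> ?D \<union> ?B" by (auto simp: rDes_slots_def)
  moreover have "?D \<inter> ?B = {}"
  proof -
    have False if "i \<in> rDes_slots r w" "n < w ! i + r" for i
    proof -
      have "w ! (i - 1) \<le> n" using le that(1) by (auto simp: rDes_slots_def)
      then show False using that by (auto simp: rDes_slots_def)
    qed
    then show ?thesis by blast
  qed
  moreover have "finite ?B" by simp
  ultimately show ?thesis
    by (simp add: card_Un_disjoint card_slots_from[OF assms(1), of "\<lambda>a. n < a + r"])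
qed

lemma rmaj_eq: "rmaj r w = \<Sum>(rDes_slots r w) + related_pairs (\<lambda>a b. b < a \<and> a < b + r) w"
  unfolding rmaj_def rDes_eq using card_related_pairs[of w "\<lambda>a b. b < a \<and> a < b + r"] by simp

text \<open>
  The occurrences of \<open>n\<close> to the right of the inserted letter, which come from the mark, join
  the new inversions of small height; together they count all letters above \<open>n - r\<close> to the
  right of the slot. Adding the shifted descents and the position of a new descent gives the
  label of the slot.
\<close>

lemma insertion_law_rmaj:
  assumes "1 \<le> r" and le: "\<forall>a\<in>#M. a \<le> n"
  shows "insertion_law (rdes r) (rmaj r) M n (size {#a \<in># M. n < a + r#})"
proof (rule insertion_lawI[where \<phi> = "\<lambda>y w. take y w @ n # drop y w"
      and Q = "keeps_rDes r n" and low = "\<lambda>_. False"])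
  fix y assume "y < Suc (size M)"
  then show "bij_betw (\<lambda>w. take y w @ n # drop y w) (permutations_of_multiset M)
      {w \<in> permutations_of_multiset (add_mset n M). w ! y = n}"
    by (rule bij_betw_insert_letter)
next
  fix w y assume w: "mset w = M" and y: "y < Suc (size M)"
  let ?v = "take y w @ n # drop y w"
  have len: "length w = size M" using w by (metis size_mset)
  have le_w: "\<forall>a\<in>set w. a \<le> n" using le w by auto
  note count = sum_card_rDes_insert_largest[OF assms(1) _ le_w, of y]
  show "rdes r ?v = rdes r w + (if keeps_rDes r n w y \<or> False then 0 else 1)"
    using count(1) y len by (simp add: rdes_def rDes_eq)
  let ?R = "\<lambda>a b. b < a \<and> a < b + r"
  have "length (filter (\<lambda>a. ?R a n) (take y w)) = 0"
    using le_w by (fastforce simp: filter_empty_conv dest: in_set_takeD)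
  then have inv: "related_pairs ?R ?v = related_pairs ?R w + length (filter (?R n) (drop y w))"
    using related_pairs_insert[of ?R "take y w" n "drop y w"] by simp
  have big: "length (filter (?R n) u) + count_list u n = length (filter (\<lambda>a. n < a + r) u)"
    if "\<forall>a\<in>set u. a \<le> n" for u
    using that assms(1) by (induction u) auto
  have "\<forall>a\<in>set (drop y w). a \<le> n" using le_w by (auto dest: in_set_dropD)
  note big = big[OF this]
  have "count_list (drop (Suc y) ?v) n = count_list (drop y w) n"
    using y len by simp
  then have "rmaj r ?v + count_list (drop (Suc y) ?v) n
      = rmaj r w + (if keeps_rDes r n w y then 0 else Suc y) + card {i \<in> rDes_slots r w. y \<le> i}
        + length (filter (\<lambda>a. n < a + r) (drop y w))"
    using count(2) y len inv big by (simp add: rmaj_eq)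
  moreover have "Suc (card {i \<in> rDes_slots r w. y \<le> i} + length (filter (\<lambda>a. n < a + r) (drop y w)))
      = card {j. y < j \<and> j < Suc (length w) \<and> keeps_rDes r n w j} + (if keeps_rDes r n w y then 1 else 0)"
  proof -
    have "{j. y \<le> j \<and> j < Suc (length w) \<and> keeps_rDes r n w j}
        = {j. y < j \<and> j < Suc (length w) \<and> keeps_rDes r n w j} \<union> (if keeps_rDes r n w y then {y} else {})"
      using y len by (auto simp: le_less)
    then show ?thesis
      using card_keeps_rDes_from[OF _ le_w, of y r] y len
      by (cases "keeps_rDes r n w y") simp_all
  qed
  ultimately show "rmaj r ?v + count_list (drop (Suc y) ?v) n
      = rmaj r w + slot_label (keeps_rDes r n w) (Suc (size M)) y"
    using len by (auto simp: slot_label_def split: if_splits)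
next
  fix w assume w: "mset w = M"
  have len: "length w = size M" using w by (metis size_mset)
  have le_w: "\<forall>a\<in>set w. a \<le> n" using le w by auto
  have "size {#a \<in># M. n < a + r#} = length (filter (\<lambda>a. n < a + r) w)"
    by (simp flip: w mset_filter)
  then show "card {y. y < Suc (size M) \<and> (keeps_rDes r n w y \<or> False)}
      = Suc (rdes r w + size {#a \<in># M. n < a + r#})"
    using card_keeps_rDes_from[OF _ le_w, of 0 r] len by (simp add: rdes_def rDes_eq)
qed simp

section \<open>Denert's statistic on filled columns\<close>

text \<open>
  A word is read as a row of cells, each a column with its letter. The relation \<open>E c a\<close> says
  that \<open>a\<close> is an excedance in column \<open>c\<close>, \<open>pos c\<close> is the index of the column, and
  \<open>B a\<close> is the gap term of Denert's statistic.
\<close>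

definition exc_letters :: "('c \<Rightarrow> nat \<Rightarrow> bool) \<Rightarrow> ('c \<times> nat) list \<Rightarrow> nat list" where
  "exc_letters E cells = map snd (filter (\<lambda>x. E (fst x) (snd x)) cells)"

definition nexc_letters :: "('c \<Rightarrow> nat \<Rightarrow> bool) \<Rightarrow> ('c \<times> nat) list \<Rightarrow> nat list" where
  "nexc_letters E cells = map snd (filter (\<lambda>x. \<not> E (fst x) (snd x)) cells)"

definition denert ::
  "('c \<Rightarrow> nat \<Rightarrow> bool) \<Rightarrow> ('c \<Rightarrow> nat) \<Rightarrow> (nat \<Rightarrow> nat) \<Rightarrow> ('c \<times> nat) list \<Rightarrow> nat" where
  "denert E pos B cells =
     (\<Sum>x\<leftarrow>filter (\<lambda>x. E (fst x) (snd x)) cells. pos (fst x) + B (snd x))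
     + related_pairs (\<ge>) (exc_letters E cells) + related_pairs (>) (nexc_letters E cells)"

text \<open>
  The amount that a letter \<open>b\<close> carried between the cells \<open>P\<close> and \<open>R\<close> contributes to Denert's
  statistic when it is counted there as an excedance (\<open>t\<close> true) or as a non-excedance. The
  position of an excedance is left out, since a carried letter occupies no column.
\<close>

definition carry_weight ::
  "('c \<Rightarrow> nat \<Rightarrow> bool) \<Rightarrow> (nat \<Rightarrow> nat) \<Rightarrow> bool \<Rightarrow> ('c \<times> nat) list \<Rightarrow> nat \<Rightarrow> ('c \<times> nat) list \<Rightarrow> nat"
where
  "carry_weight E B t P b R =
     (if t then B b + length (filter (\<lambda>a. b \<le> a) (exc_letters E P))
                    + length (filter (\<lambda>a. a \<le> b) (exc_letters E R))
      else length (filter (\<lambda>a. b < a) (nexc_letters E P))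
           + length (filter (\<lambda>a. a < b) (nexc_letters E R)))"

text \<open>
  The carried letter is exchanged with the letter of a column when both are excedances there or
  both are not. Every column thus keeps its type, and the rule undoes itself when it is read from
  right to left. The letter carried at the end fills the new column \<open>z\<close>.
\<close>

fun bump :: "('c \<Rightarrow> nat \<Rightarrow> bool) \<Rightarrow> 'c \<Rightarrow> nat \<Rightarrow> ('c \<times> nat) list \<Rightarrow> ('c \<times> nat) list" where
  "bump E z b [] = [(z, b)]"
| "bump E z b (x # R) =
     (if E (fst x) b = E (fst x) (snd x) then (fst x, b) # bump E z (snd x) R else x # bump E z b R)"

definition insert_bump ::
  "('c \<Rightarrow> nat \<Rightarrow> bool) \<Rightarrow> 'c \<Rightarrow> nat \<Rightarrow> nat \<Rightarrow> ('c \<times> nat) list \<Rightarrow> ('c \<times> nat) list" where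
  "insert_bump E z n y cells = (case drop y cells of
       [] \<Rightarrow> cells @ [(z, n)]
     | x # R \<Rightarrow> take y cells @ (fst x, n) # bump E z (snd x) R)"

lemma exc_letters_simps [simp]:
  "exc_letters E [] = []"
  "exc_letters E (P @ R) = exc_letters E P @ exc_letters E R"
  "exc_letters E (x # R) = (if E (fst x) (snd x) then snd x # exc_letters E R else exc_letters E R)"
  by (simp_all add: exc_letters_def)

lemma nexc_letters_simps [simp]:
  "nexc_letters E [] = []"
  "nexc_letters E (P @ R) = nexc_letters E P @ nexc_letters E R"
  "nexc_letters E (x # R) = (if E (fst x) (snd x) then nexc_letters E R else snd x # nexc_letters E R)"
  by (simp_all add: nexc_letters_def)

lemma denert_insert:
  "denert E pos B (P @ (c, b) # R)
    = denert E pos B (P @ R) + (if E c b then pos c else 0) + carry_weight E B (E c b) P b R"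
  by (simp add: denert_def carry_weight_def related_pairs_insert)

lemma carry_weight_swap:
  assumes "E c a = t" and "E c b = t"
  shows "carry_weight E B t P b R + carry_weight E B t (P @ [(c, b)]) a R
    = carry_weight E B t P a R + carry_weight E B t P b ((c, a) # R)"
  using assms by (auto simp: carry_weight_def)

lemma carry_weight_skip:
  assumes "E c a \<noteq> t"
  shows "carry_weight E B t (P @ [(c, a)]) b R = carry_weight E B t P b ((c, a) # R)"
  using assms by (auto simp: carry_weight_def)

lemma map_fst_bump [simp]: "map fst (bump E z b R) = map fst R @ [z]"
  by (induction R arbitrary: b) auto

lemma mset_bump [simp]: "mset (map snd (bump E z b R)) = add_mset b (mset (map snd R))"
  by (induction R arbitrary: b) auto

text \<open>
  The letter left in a column and the letter carried away from it have equal types exactly when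
  they were exchanged, so the steps can be undone from the last column on.
\<close>

lemma bump_inj:
  assumes "bump E z b R = bump E z b' R'" and "map fst R = map fst R'"
  shows "b = b' \<and> R = R'"
  using assms
proof (induction R arbitrary: b b' R')
  case (Cons x R)
  then obtain x' R'' where R': "R' = x' # R''" and fst: "fst x' = fst x" "map fst R = map fst R''"
    by (cases R') auto
  obtain c a a' where x: "x = (c, a)" "x' = (c, a')"
    using fst(1) by (cases x; cases x') auto
  have IH: "d = d' \<and> R = R''" if "bump E z d R = bump E z d' R''" for d d'
    using Cons.IH[OF that fst(2)] .
  have eq: "(if E c b = E c a then (c, b) # bump E z a R else (c, a) # bump E z b R)
      = (if E c b' = E c a' then (c, b') # bump E z a' R'' else (c, a') # bump E z b' R'')"
    using Cons.prems(1) by (simp only: R' x bump.simps fst_conv snd_conv)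
  show ?case
  proof (cases "E c b = E c a"; cases "E c b' = E c a'")
    assume "E c b = E c a" "E c b' = E c a'"
    then show ?thesis using eq IH[of a a'] by (simp add: R' x)
  next
    assume types: "E c b = E c a" "E c b' \<noteq> E c a'"
    then have "b = a'" "a = b'" using eq IH[of a b'] by simp_all
    with types show ?thesis by blast
  next
    assume types: "E c b \<noteq> E c a" "E c b' = E c a'"
    then have "a = b'" "b = a'" using eq IH[of b a'] by simp_all
    with types show ?thesis by blast
  next
    assume "E c b \<noteq> E c a" "E c b' \<noteq> E c a'"
    then show ?thesis using eq IH[of b b'] by (simp add: R' x)
  qed
qed auto

lemma insert_bump_last: "insert_bump E z n (length cells) cells = cells @ [(z, n)]"
  by (simp add: insert_bump_def)

lemma insert_bump_at:
  "insert_bump E z n (length P) (P @ (c, b) # R) = P @ (c, n) # bump E z b R"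
  by (simp add: insert_bump_def)

lemma cells_cases:
  assumes "y \<le> length cells"
  obtains (last) "y = length cells" | (at) P c b R where "cells = P @ (c, b) # R" "y = length P"
proof (cases "y = length cells")
  case False
  then have "y < length cells" using assms by simp
  then have "cells = take y cells @ (fst (cells ! y), snd (cells ! y)) # drop (Suc y) cells"
    using id_take_nth_drop[of y cells] by (simp only: prod.collapse)
  moreover have "y = length (take y cells)" using \<open>y < length cells\<close> by simp
  ultimately show ?thesis by (rule at)
qed (rule last)

lemma map_fst_insert_bump:
  assumes "y \<le> length cells"
  shows "map fst (insert_bump E z n y cells) = map fst cells @ [z]"
  using assms by (cases rule: cells_cases) (auto simp: insert_bump_last insert_bump_at)

lemma mset_insert_bump:
  assumes "y \<le> length cells"
  shows "mset (map snd (insert_bump E z n y cells)) = add_mset n (mset (map snd cells))"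
  using assms
  by (cases rule: cells_cases) (auto simp: insert_bump_last insert_bump_at simp flip: mset_map)

lemma snd_nth_insert_bump:
  assumes "y \<le> length cells"
  shows "map snd (insert_bump E z n y cells) ! y = n"
  using assms by (cases rule: cells_cases) (auto simp: insert_bump_last insert_bump_at nth_append)

lemma count_after_insert_bump:
  assumes "y \<le> length cells"
  shows "count_list (drop (Suc y) (map snd (insert_bump E z n y cells))) n
    = count_list (map snd (drop y cells)) n"
  using assms
proof (cases rule: cells_cases)
  case (at P c b R)
  have "count_list (map snd (bump E z b R)) n = count_list (b # map snd R) n"
    by (simp only: count_mset[symmetric] mset_bump mset.simps)
  then show ?thesis
    using at by (simp add: insert_bump_at)
qed (simp add: insert_bump_last)

lemma insert_bump_inj:
  assumes "insert_bump E z n y cells = insert_bump E z n y cells'"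
    and fst: "map fst cells = map fst cells'" and "y \<le> length cells"
  shows "cells = cells'"
  using assms(3)
proof (cases rule: cells_cases)
  case last
  have "length cells' = length cells" using fst by (metis length_map)
  then have "cells @ [(z, n)] = cells' @ [(z, n)]"
    using assms(1) insert_bump_last[of E z n cells] insert_bump_last[of E z n cells']
    by (simp only: last)
  then show ?thesis by simp
next
  case (at P c b R)
  define P' R'' where "P' = take y cells'" and "R'' = drop y cells'"
  have "length cells' = length cells" using fst by (metis length_map)
  then have cells': "cells' = P' @ R''" and len: "length P' = length P"
    unfolding P'_def R''_def using assms(3) at(2) by simp_all
  have "map fst P @ c # map fst R = map fst P' @ map fst R''"
    using fst unfolding at(1) cells' by simp
  then have "c # map fst R = map fst R''"
    using len by (metis append_eq_append_conv length_map)
  then obtain x R' where x: "R'' = x # R'" "fst x = c" and fst': "map fst R = map fst R'"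
    by (metis map_eq_Cons_conv)
  then obtain b' where R'': "R'' = (c, b') # R'"
    by (metis prod.collapse)
  have "P @ (c, n) # bump E z b R = P' @ (c, n) # bump E z b' R'"
    using assms(1) insert_bump_at[of E z n P c b R] insert_bump_at[of E z n P' c b' R']
    by (simp only: at cells' R'' len)
  then have "P = P'" and "bump E z b R = bump E z b' R'"
    using len by simp_all
  with bump_inj[OF _ fst'] show ?thesis
    unfolding at(1) cells' R'' by blast
qed

section \<open>The effect of bumping on the statistics\<close>

text \<open>
  \<open>M\<close> holds the letters of the shorter words, \<open>cols\<close> their columns, and \<open>z\<close> is the new column.
  The excedance relation has the shape of a Ferrers board, and the board is linked to the gap
  term: if \<open>b\<close> is an excedance in some column, the letters below \<open>b\<close> are as many as the columns
  in which \<open>b\<close> is an excedance, increased by \<open>B b\<close>.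
\<close>

locale bumping =
  fixes E :: "'c \<Rightarrow> nat \<Rightarrow> bool" and pos :: "'c \<Rightarrow> nat" and B :: "nat \<Rightarrow> nat"
    and n :: nat and M :: "nat multiset" and cols :: "'c list" and z :: 'c
  assumes E_letter: "E c a \<Longrightarrow> a \<le> b \<Longrightarrow> E c b"
    and E_column: "sorted_wrt (\<lambda>c c'. \<forall>a. E c' a \<longrightarrow> E c a) (cols @ [z])"
    and E_last: "a \<le> n \<Longrightarrow> \<not> E z a"
    and le_n: "\<forall>a\<in>#M. a \<le> n"
    and count_columns: "c \<in> set cols \<Longrightarrow> E c b \<Longrightarrow> b \<le> n \<Longrightarrow>
      length (filter (\<lambda>c. E c b) cols) + B b = size {#a \<in># M. a < b#}"
    and pos_column: "y < length cols \<Longrightarrow> pos (cols ! y) = Suc y"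
begin

definition carrying :: "('c \<times> nat) list \<Rightarrow> nat \<Rightarrow> ('c \<times> nat) list \<Rightarrow> bool" where
  "carrying P b R \<longleftrightarrow>
     map fst (P @ R) = cols \<and> add_mset b (mset (map snd (P @ R))) = add_mset n M"

lemma carrying_le:
  assumes "carrying P b R"
  shows "b \<le> n" and "x \<in> set P \<union> set R \<Longrightarrow> snd x \<le> n"
proof -
  have le: "a \<le> n" if "a \<in># add_mset n M" for a using that le_n by auto
  have eq: "add_mset n M = add_mset b (mset (map snd (P @ R)))"
    using assms by (simp add: carrying_def)
  show "b \<le> n" by (rule le) (simp add: eq)
  show "snd x \<le> n" if "x \<in> set P \<union> set R"
    by (rule le) (use that in \<open>auto simp: eq\<close>)
qed

text \<open>
  When the carried letter \<open>b\<close> passes the last column where it is an excedance, its two weights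
  agree. On the left all letters that are at least \<open>b\<close> are excedances, on the right all
  excedances are larger than \<open>b\<close>. Therefore the difference of the weights reduces to a count of
  the letters below \<open>b\<close>, which is \<open>length P + B b\<close>.
\<close>

lemma carry_weight_change:
  assumes carry: "carrying P b R" and "P \<noteq> []"
    and P: "\<And>x. x \<in> set P \<Longrightarrow> E (fst x) b" and R: "\<And>x. x \<in> set R \<Longrightarrow> \<not> E (fst x) b"
  shows "carry_weight E B True P b R = carry_weight E B False P b R"
proof -
  have exc_R: "b < snd x" if "x \<in> set R" "E (fst x) (snd x)" for x
    using E_letter[OF that(2)] R[OF that(1)] by (meson not_le)
  have nexc_P: "snd x < b" if "x \<in> set P" "\<not> E (fst x) (snd x)" for x
    using E_letter[OF P[OF that(1)]] that(2) by (meson not_le)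
  have le: "b \<le> n" by (rule carrying_le[OF carry])
  have cols: "cols = map fst P @ map fst R"
    and letters: "add_mset b (mset (map snd (P @ R))) = add_mset n M"
    using carry by (auto simp: carrying_def)
  have "filter (\<lambda>c. E c b) cols = map fst P"
    using P R by (simp add: cols filter_id_conv filter_empty_conv)
  moreover obtain x where "x \<in> set P" using \<open>P \<noteq> []\<close> by (cases P) auto
  ultimately have "length P + B b = size {#a \<in># M. a < b#}"
    using count_columns[of "fst x" b] P[of x] le by (simp add: cols)
  also have "{#a \<in># M. a < b#} = {#a \<in># add_mset n M. a < b#}"
    using le by simp
  also have "size \<dots> = length (filter (\<lambda>x. snd x < b) P) + length (filter (\<lambda>x. snd x < b) R)"
    unfolding letters[symmetric]
    by (simp add: filter_mset_image_mset size_mset[symmetric] del: size_mset flip: mset_filter mset_map)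
       (simp add: filter_map comp_def)
  finally have "B b + length (filter (\<lambda>x. b \<le> snd x) P) = length (filter (\<lambda>x. snd x < b) R)"
    using sum_length_filter_compl[of "\<lambda>x. snd x < b" P] by (simp add: not_less)
  moreover have "filter (\<lambda>x. E (fst x) (snd x) \<and> b \<le> snd x) P = filter (\<lambda>x. b \<le> snd x) P"
    using nexc_P by (intro filter_cong) (auto simp: not_le[symmetric])
  moreover have "filter (\<lambda>x. \<not> E (fst x) (snd x) \<and> b < snd x) P = []"
    using nexc_P by (fastforce simp: filter_empty_conv)
  moreover have "filter (\<lambda>x. \<not> E (fst x) (snd x) \<and> snd x < b) R = filter (\<lambda>x. snd x < b) R"
    using exc_R by (intro filter_cong) (auto dest: less_asym)
  moreover have "filter (\<lambda>x. E (fst x) (snd x) \<and> snd x \<le> b) R = []"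
    using exc_R by (fastforce simp: filter_empty_conv)
  ultimately show ?thesis
    by (simp add: carry_weight_def exc_letters_def nexc_letters_def filter_map comp_def conj_commute)
qed

text \<open>
  The statistic of the columns together with the weight of the carried letter is invariant along
  the scan: exchanging two letters of one type swaps their roles, a skipped column is invisible to
  a letter of the other type, and a change of type costs nothing by \<open>carry_weight_change\<close>.
\<close>

lemma denert_bump:
  assumes "carrying P b R"
  shows "denert E pos B (P @ bump E z b R)
    = denert E pos B (P @ R) + carry_weight E B (E (fst (hd (R @ [(z, b)]))) b) P b R"
  using assms
proof (induction R arbitrary: P b)
  case Nil
  then have "\<not> E z b" using carrying_le(1) E_last by blast
  then show ?case using denert_insert[of E pos B P z b "[]"] by simp
next
  case (Cons x R)
  obtain c a where x: "x = (c, a)" by (cases x)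
  note carry = Cons.prems[unfolded x]
  define c' where "c' = fst (hd (R @ [(z, b)]))"
  have c': "c' = fst (hd (R @ [(z, d)]))" for d by (cases R) (auto simp: c'_def)
  obtain T where T: "map fst R @ [z] = c' # T" by (cases R) (auto simp: c'_def)
  have cols: "cols = map fst P @ c # map fst R" using carry by (auto simp: carrying_def)
  then have "cols @ [z] = map fst P @ c # c' # T" using T by simp
  then have sorted: "sorted_wrt (\<lambda>c c'. \<forall>a. E c' a \<longrightarrow> E c a) (map fst P @ c # c' # T)"
    using E_column by simp
  have later: "E c d" if "E c' d" for d
    using that sorted by (simp only: sorted_wrt_append sorted_wrt.simps list.set) blast
  have earlier: "E (fst y) d" if "E c d" "y \<in> set P" for d y
    using that sorted by (simp only: sorted_wrt_append sorted_wrt.simps list.set set_map) blast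
  have none_after: "\<not> E (fst y) d" if "\<not> E c' d" "y \<in> set R" for d y
  proof -
    have "fst y \<in> set (map fst R @ [z])" using that(2) by simp
    then have "fst y = c' \<or> fst y \<in> set T" unfolding T by simp
    moreover have "\<forall>c\<in>set T. \<forall>a. E c a \<longrightarrow> E c' a"
      using sorted by (simp only: sorted_wrt_append sorted_wrt.simps) blast
    ultimately show ?thesis using that(1) by blast
  qed
  \<comment> \<open>the induction hypothesis weighs the carried letter by its type in the next column; where this
    differs from its type in the present one, the two weights coincide\<close>
  have release: "carry_weight E B (E c' d) (P @ [(c, e)]) d R = carry_weight E B (E c d) (P @ [(c, e)]) d R"
    if "carrying (P @ [(c, e)]) d R" for d e
  proof (cases "E c d \<and> \<not> E c' d")
    case True
    have "carry_weight E B True (P @ [(c, e)]) d R = carry_weight E B False (P @ [(c, e)]) d R"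
    proof (rule carry_weight_change[OF that])
      show "E (fst y) d" if "y \<in> set (P @ [(c, e)])" for y
        using that True earlier[of d y] by (cases "y \<in> set P") simp_all
      show "\<not> E (fst y) d" if "y \<in> set R" for y
        using that True none_after[of d y] by blast
    qed simp
    then show ?thesis using True by simp
  next
    case False
    then have "E c' d = E c d" using later by blast
    then show ?thesis by simp
  qed
  show ?case
  proof (cases "E c b = E c a")
    case True
    have carry': "carrying (P @ [(c, b)]) a R"
      using carry by (auto simp: carrying_def add_mset_commute)
    have "denert E pos B (P @ bump E z b (x # R))
        = denert E pos B (P @ (c, b) # R) + carry_weight E B (E c' a) (P @ [(c, b)]) a R"
      using Cons.IH[OF carry'] True by (simp add: x c'[of a])
    then show ?thesis
      using release[OF carry'] carry_weight_swap[of E c a "E c a" b B P R] True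
      by (simp add: x denert_insert)
  next
    case False
    have carry': "carrying (P @ [(c, a)]) b R"
      using carry by (simp add: carrying_def)
    have "denert E pos B (P @ bump E z b (x # R))
        = denert E pos B (P @ (c, a) # R) + carry_weight E B (E c' b) (P @ [(c, a)]) b R"
      using Cons.IH[OF carry'] False by (simp add: x c'[of b])
    then show ?thesis
      using release[OF carry'] carry_weight_skip[of E c a "E c b" B P b R] False
      by (simp add: x)
  qed
qed

end

text \<open>
  The last slot is the new column: there \<open>n\<close> displaces no letter and is no excedance.
\<close>

definition keeps_exc :: "('c \<Rightarrow> nat \<Rightarrow> bool) \<Rightarrow> nat \<Rightarrow> ('c \<times> nat) list \<Rightarrow> nat \<Rightarrow> bool" where
  "keeps_exc E n cells y \<longleftrightarrow> y = length cells \<or>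
     y < length cells \<and> E (fst (cells ! y)) n = E (fst (cells ! y)) (snd (cells ! y))"

lemma card_keeps_exc_from:
  assumes "y \<le> length cells"
  shows "card {j. y \<le> j \<and> j < Suc (length cells) \<and> keeps_exc E n cells j}
    = Suc (length (filter (\<lambda>x. E (fst x) n = E (fst x) (snd x)) (drop y cells)))"
proof -
  have "{j. y \<le> j \<and> j < Suc (length cells) \<and> keeps_exc E n cells j}
      = insert (length cells)
          {j. y \<le> j \<and> j < length cells \<and> E (fst (cells ! j)) n = E (fst (cells ! j)) (snd (cells ! j))}"
    using assms by (auto simp: keeps_exc_def)
  then show ?thesis
    using card_slots_from[OF assms, of "\<lambda>x. E (fst x) n = E (fst x) (snd x)"] by simp
qed

context bumping
begin

lemma length_filter_keeps:
  assumes "\<And>x. x \<in> set L \<Longrightarrow> snd x \<le> n"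
  shows "length (filter (\<lambda>x. E (fst x) n = E (fst x) (snd x)) L)
    = length (filter (\<lambda>x. \<not> E (fst x) n) L) + length (exc_letters E L)"
  using assms by (induction L) (auto dest: E_letter)

lemma length_filter_largest_exc:
  assumes "\<And>x. x \<in> set L \<Longrightarrow> snd x \<le> n" and "\<And>x. x \<in> set L \<Longrightarrow> E (fst x) n"
  shows "length (filter (\<lambda>a. n \<le> a) (exc_letters E L)) = count_list (map snd L) n"
  using assms by (induction L) (auto simp: le_antisym)

context
  fixes cells :: "('c \<times> nat) list"
  assumes cells_columns: "map fst cells = cols" and cells_letters: "mset (map snd cells) = M"
begin

lemma cells_le: "x \<in> set cells \<Longrightarrow> snd x \<le> n"
  using le_n cells_letters by fastforce

lemma sorted_cells: "sorted_wrt (\<lambda>c c'. \<forall>a. E c' a \<longrightarrow> E c a) (map fst cells @ [z])"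
  using E_column by (simp add: cells_columns)

lemma exc_earlier:
  assumes "cells = P @ x # R" and "E (fst x) a" and "y \<in> set P"
  shows "E (fst y) a"
proof -
  have "\<forall>y\<in>set P. \<forall>a. E (fst x) a \<longrightarrow> E (fst y) a"
    using sorted_cells by (simp add: assms(1) sorted_wrt_append)
  then show ?thesis using assms(2,3) by blast
qed

text \<open>
  All columns in which \<open>n\<close> is no excedance lie to the right of any column in which it is one.
  By the link between board and gap term they number \<open>size M\<close>, reduced by the letters below \<open>n\<close>
  and increased by \<open>B n\<close>.
\<close>

lemma length_filter_not_exc:
  assumes cells: "cells = P @ x # R" and "E (fst x) n"
  shows "length (filter (\<lambda>x. \<not> E (fst x) n) R) = B n + count M n"
proof -
  have P: "filter (\<lambda>x. \<not> E (fst x) n) P = []"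
    using exc_earlier[OF assms] by (simp add: filter_empty_conv)
  have "length (filter (\<lambda>c. E c n) cols) + length (filter (\<lambda>c. \<not> E c n) cols) = size M"
    using sum_length_filter_compl[of "\<lambda>c. E c n" cols] cells_columns cells_letters
    by (metis length_map size_mset)
  moreover have "length (filter (\<lambda>c. \<not> E c n) cols) = length (filter (\<lambda>x. \<not> E (fst x) n) R)"
    using P assms(2) by (simp add: cells_columns[symmetric] cells filter_map comp_def)
  moreover have "length (filter (\<lambda>c. E c n) cols) + B n = size {#a \<in># M. a < n#}"
    using count_columns[of "fst x" n] assms(2) by (simp add: cells_columns[symmetric] cells)
  moreover have "size M = size {#a \<in># M. a < n#} + count M n"
  proof -
    have "{#a \<in># M. \<not> a < n#} = {#a \<in># M. a = n#}"
      using le_n by (intro filter_mset_cong refl) auto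
    then have "size {#a \<in># M. \<not> a < n#} = count M n"
      by (simp add: filter_eq_replicate_mset)
    moreover have "size M = size {#a \<in># M. a < n#} + size {#a \<in># M. \<not> a < n#}"
      using multiset_partition[of M "\<lambda>a. a < n"] by (metis size_union)
    ultimately show ?thesis by simp
  qed
  ultimately show ?thesis by simp
qed

lemma count_split:
  assumes "cells = P @ R"
  shows "count_list (map snd P) n + count_list (map snd R) n = count M n"
proof -
  have "count M n = count_list (map snd cells) n"
    by (metis cells_letters count_mset)
  then show ?thesis by (simp add: assms)
qed

text \<open>
  If \<open>n\<close> goes to the new column or has the type of the letter that it displaces, the whole
  insertion is a bump that starts by carrying \<open>n\<close>, so the gain is the carry weight of \<open>n\<close> alone.
\<close>

lemma denert_insert_bump_keeping:
  assumes y: "y \<le> length cells" and keeps: "keeps_exc E n cells y"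
  shows "denert E pos B (insert_bump E z n y cells)
      + count_list (drop (Suc y) (map snd (insert_bump E z n y cells))) n
    = denert E pos B cells + slot_label (keeps_exc E n cells) (Suc (length cells)) y"
proof -
  define P R where "P = take y cells" and "R = drop y cells"
  have cells: "cells = P @ R" by (simp add: P_def R_def)
  have bump: "insert_bump E z n y cells = P @ bump E z n R"
    using y
  proof (cases rule: cells_cases)
    case (at P' c b R')
    then have "E c n = E c b" using keeps by (simp add: keeps_exc_def nth_append)
    then show ?thesis using at by (simp add: P_def R_def insert_bump_at)
  qed (simp add: P_def R_def insert_bump_last)
  have "carrying P n R"
    using cells_columns cells_letters by (simp add: carrying_def cells)
  then have den: "denert E pos B (insert_bump E z n y cells)
      = denert E pos B cells + carry_weight E B (E (fst (hd (R @ [(z, n)]))) n) P n R"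
    unfolding bump by (subst denert_bump) (simp_all add: cells)
  have le_P: "snd x \<le> n" if "x \<in> set P" for x using cells_le that by (simp add: cells)
  have le_R: "snd x \<le> n" if "x \<in> set R" for x using cells_le that by (simp add: cells)
  have label: "Suc (slot_label (keeps_exc E n cells) (Suc (length cells)) y)
      = Suc (length (filter (\<lambda>x. E (fst x) n = E (fst x) (snd x)) R))"
  proof -
    have "{j. y \<le> j \<and> j < Suc (length cells) \<and> keeps_exc E n cells j}
        = insert y {j. y < j \<and> j < Suc (length cells) \<and> keeps_exc E n cells j}"
      using y keeps by (auto simp: le_less)
    then show ?thesis
      using card_keeps_exc_from[OF y, of E n] keeps by (simp add: slot_label_def R_def)
  qed
  have after: "count_list (drop (Suc y) (map snd (insert_bump E z n y cells))) n = count_list (map snd R) n"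
    using count_after_insert_bump[OF y] by (simp add: R_def)
  have "carry_weight E B (E (fst (hd (R @ [(z, n)]))) n) P n R + count_list (map snd R) n
      = length (filter (\<lambda>x. E (fst x) n = E (fst x) (snd x)) R)"
  proof (cases "E (fst (hd (R @ [(z, n)]))) n")
    case True
    moreover have "\<not> E z n" using E_last by blast
    ultimately obtain x R' where R: "R = x # R'" and x: "E (fst x) n" by (cases R) auto
    have P: "E (fst y) n" if "y \<in> set P" for y
      using exc_earlier[OF cells[unfolded R] x that] .
    have "filter (\<lambda>a. a \<le> n) (exc_letters E R) = exc_letters E R"
      using le_R by (auto simp: filter_id_conv exc_letters_def)
    then have "carry_weight E B True P n R + count_list (map snd R) n
        = B n + count M n + length (exc_letters E R)"
      using length_filter_largest_exc[OF le_P P] count_split[OF cells] by (simp add: carry_weight_def)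
    also have "\<dots> = length (filter (\<lambda>x. E (fst x) n = E (fst x) (snd x)) R)"
      using length_filter_keeps[of R, OF le_R] length_filter_not_exc[OF cells[unfolded R] x] x
      by (simp add: R)
    finally show ?thesis using True by simp
  next
    case False
    have R: "\<not> E (fst x) n" if "x \<in> set R" for x
    proof (cases R)
      case (Cons x' R')
      then have "x = x' \<or> x \<in> set R'" using that by simp
      moreover have "\<forall>x\<in>set R'. \<forall>a. E (fst x) a \<longrightarrow> E (fst x') a"
        using sorted_cells by (simp add: cells Cons sorted_wrt_append)
      ultimately show ?thesis using False Cons by auto
    qed (use that in simp)
    have R': "\<not> E (fst x) (snd x)" if "x \<in> set R" for x
      using R[OF that] E_letter[OF _ le_R[OF that]] by blast
    have nexc_R: "nexc_letters E R = map snd R"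
      using R' by (simp add: nexc_letters_def)
    have "filter (\<lambda>a. n < a) (nexc_letters E P) = []"
      using le_P by (fastforce simp: filter_empty_conv nexc_letters_def)
    moreover have "length (filter (\<lambda>a. a < n) (map snd R)) + count_list (map snd R) n = length R"
      using le_R by (induction R) (auto simp: le_less)
    ultimately have "carry_weight E B False P n R + count_list (map snd R) n = length R"
      by (simp add: carry_weight_def nexc_R)
    also have "\<dots> = length (filter (\<lambda>x. E (fst x) n = E (fst x) (snd x)) R)"
      using R R' by (subst filter_True) auto
    finally show ?thesis using False by simp
  qed
  then show ?thesis using den label after by simp
qed

text \<open>
  If the types differ, \<open>n\<close> becomes an excedance in a column that had none. The displaced letter
  is and remains a non-excedance, and by invariance it contributes what it contributed before, so
  the gain is the position and the carry weight of \<open>n\<close>.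
\<close>

lemma denert_insert_bump_changing:
  assumes y: "y \<le> length cells" and changes: "\<not> keeps_exc E n cells y"
  shows "denert E pos B (insert_bump E z n y cells)
      + count_list (drop (Suc y) (map snd (insert_bump E z n y cells))) n
    = denert E pos B cells + slot_label (keeps_exc E n cells) (Suc (length cells)) y"
  using y
proof (cases rule: cells_cases)
  case last
  then show ?thesis using changes by (simp add: keeps_exc_def)
next
  case (at P c b R)
  have types: "E c n \<noteq> E c b" using changes at by (simp add: keeps_exc_def nth_append)
  have "b \<le> n" using cells_le[of "(c, b)"] by (simp add: at)
  then have exc: "E c n" "\<not> E c b" using types E_letter by blast+
  have le_P: "snd x \<le> n" if "x \<in> set P" for x using cells_le that by (simp add: at)
  have le_R: "snd x \<le> n" if "x \<in> set R" for x using cells_le that by (simp add: at)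
  have P: "E (fst x) n" if "x \<in> set P" for x
    using exc_earlier[OF at(1)] that exc(1) by simp
  have "pos c = Suc y"
    using pos_column[of y] at by (simp add: cells_columns[symmetric] nth_append)
  have "carrying (P @ [(c, n)]) b R"
    using cells_columns cells_letters by (auto simp: carrying_def at add_mset_commute)
  moreover have "\<not> E (fst (hd (R @ [(z, b)]))) b"
  proof -
    have "fst (hd (R @ [(z, b)])) \<in> set (map fst R @ [z])" by (cases R) auto
    moreover have "\<forall>c'\<in>set (map fst R @ [z]). \<forall>a. E c' a \<longrightarrow> E c a"
      using sorted_cells by (simp add: at sorted_wrt_append)
    ultimately show ?thesis using exc(2) by blast
  qed
  ultimately have "denert E pos B (insert_bump E z n y cells)
      = denert E pos B (P @ (c, n) # R) + carry_weight E B False (P @ [(c, n)]) b R"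
    using denert_bump[of "P @ [(c, n)]" b R] by (simp add: at insert_bump_at)
  also have "carry_weight E B False (P @ [(c, n)]) b R = carry_weight E B False P b R"
    using exc(1) by (simp add: carry_weight_def)
  also have "denert E pos B (P @ (c, n) # R) + \<dots>
      = denert E pos B cells + Suc y + carry_weight E B True P n R"
    using exc \<open>pos c = Suc y\<close> by (simp add: at denert_insert)
  finally have den: "denert E pos B (insert_bump E z n y cells)
      = denert E pos B cells + Suc y + carry_weight E B True P n R" .
  have "filter (\<lambda>a. a \<le> n) (exc_letters E R) = exc_letters E R"
    using le_R by (auto simp: filter_id_conv exc_letters_def)
  then have "carry_weight E B True P n R + count_list (map snd ((c, b) # R)) n
      = B n + count M n + length (exc_letters E R)"
    using length_filter_largest_exc[OF le_P P] count_split[OF at(1)] by (simp add: carry_weight_def)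
  also have "\<dots> = length (filter (\<lambda>x. E (fst x) n = E (fst x) (snd x)) R)"
    using length_filter_keeps[of R, OF le_R] length_filter_not_exc[OF at(1)] exc(1) by simp
  finally have weight: "carry_weight E B True P n R + count_list (map snd ((c, b) # R)) n
      = length (filter (\<lambda>x. E (fst x) n = E (fst x) (snd x)) R)" .
  have "{j. y \<le> j \<and> j < Suc (length cells) \<and> keeps_exc E n cells j}
      = {j. y < j \<and> j < Suc (length cells) \<and> keeps_exc E n cells j}"
    using changes by (auto simp: le_less)
  then have "slot_label (keeps_exc E n cells) (Suc (length cells)) y
      = y + Suc (length (filter (\<lambda>x. E (fst x) n = E (fst x) (snd x)) R))"
    using card_keeps_exc_from[OF y, of E n] changes types by (simp add: slot_label_def at)
  moreover have "count_list (drop (Suc y) (map snd (insert_bump E z n y cells))) n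
      = count_list (map snd ((c, b) # R)) n"
    using count_after_insert_bump[OF y] by (simp add: at)
  ultimately show ?thesis using den weight by simp
qed

lemma denert_insert_bump:
  assumes "y \<le> length cells"
  shows "denert E pos B (insert_bump E z n y cells)
      + count_list (drop (Suc y) (map snd (insert_bump E z n y cells))) n
    = denert E pos B cells + slot_label (keeps_exc E n cells) (Suc (length cells)) y"
  using denert_insert_bump_keeping denert_insert_bump_changing assms by blast

end

lemma count_exc_bump:
  assumes "b \<le> n" and "\<And>x. x \<in> set R \<Longrightarrow> snd x \<le> n"
  shows "length (filter (\<lambda>x. E (fst x) (snd x) \<and> L (fst x)) (bump E z b R))
    = length (filter (\<lambda>x. E (fst x) (snd x) \<and> L (fst x)) R)"
  using assms by (induction R arbitrary: b) (auto simp: E_last)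

lemma count_exc_insert_bump:
  assumes y: "y \<le> length cells" and le: "\<And>x. x \<in> set cells \<Longrightarrow> snd x \<le> n"
  shows "length (filter (\<lambda>x. E (fst x) (snd x) \<and> L (fst x)) (insert_bump E z n y cells))
    = length (filter (\<lambda>x. E (fst x) (snd x) \<and> L (fst x)) cells)
      + (if keeps_exc E n cells y \<or> y < length cells \<and> \<not> L (fst (cells ! y)) then 0 else 1)"
  using y
proof (cases rule: cells_cases)
  case last
  then show ?thesis using E_last[of n] by (simp add: insert_bump_last keeps_exc_def)
next
  case (at P c b R)
  have "E c b \<Longrightarrow> E c n" using E_letter[of c b n] le[of "(c, b)"] by (simp add: at)
  moreover have "length (filter (\<lambda>x. E (fst x) (snd x) \<and> L (fst x)) (bump E z b R))
      = length (filter (\<lambda>x. E (fst x) (snd x) \<and> L (fst x)) R)"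
    by (rule count_exc_bump) (use le[of "(c, b)"] le in \<open>auto simp: at\<close>)
  ultimately show ?thesis
    by (auto simp: at insert_bump_at keeps_exc_def nth_append)
qed

end

section \<open>The gap-level statistics on words\<close>

definition columns :: "nat multiset \<Rightarrow> (nat \<times> nat) list" where
  "columns M = zip [1..<Suc (size M)] (sorted_list_of_multiset M)"

definition exceeds :: "nat \<Rightarrow> nat \<Rightarrow> nat \<times> nat \<Rightarrow> nat \<Rightarrow> bool" where
  "exceeds g h c a \<longleftrightarrow> snd c + g \<le> a \<and> h \<le> a"

definition gap_count :: "nat \<Rightarrow> nat multiset \<Rightarrow> nat \<Rightarrow> nat" where
  "gap_count g M a = size {#x \<in># M. a < x + g \<and> x < a#}"

lemma length_sorted [simp]: "length (sorted_list_of_multiset M) = size M"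
  by (metis mset_sorted_list_of_multiset size_mset)

lemma length_columns [simp]: "length (columns M) = size M"
  by (simp add: columns_def del: upt_Suc)

lemma map_snd_columns: "map snd (columns M) = sorted_list_of_multiset M"
  by (simp add: columns_def del: upt_Suc)

lemma nth_columns:
  "i < size M \<Longrightarrow> columns M ! i = (Suc i, sorted_list_of_multiset M ! i)"
  by (simp add: columns_def del: upt_Suc)

lemma length_filter_columns:
  "length (filter (\<lambda>c. T (snd c)) (columns M)) = size {#x \<in># M. T x#}"
proof -
  have "length (filter (\<lambda>c. T (snd c)) (columns M)) = length (filter T (map snd (columns M)))"
    by (simp add: filter_map comp_def)
  also have "\<dots> = size {#x \<in># M. T x#}"
    by (metis map_snd_columns mset_filter mset_sorted_list_of_multiset size_mset)
  finally show ?thesis .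
qed

lemma sorted_list_of_multiset_add_largest:
  assumes "\<forall>a\<in>#M. a \<le> n"
  shows "sorted_list_of_multiset (add_mset n M) = sorted_list_of_multiset M @ [n]"
  using assms by (simp add: sorted_insort_is_snoc)

lemma columns_add_largest:
  assumes "\<forall>a\<in>#M. a \<le> n"
  shows "columns (add_mset n M) = columns M @ [(Suc (size M), n)]"
proof -
  have "[1..<Suc (Suc (size M))] = [1..<Suc (size M)] @ [Suc (size M)]"
    by (rule upt_Suc_append) simp
  then show ?thesis
    using sorted_list_of_multiset_add_largest[OF assms]
    by (simp add: columns_def del: upt_Suc sorted_list_of_multiset_insert)
qed

lemma gap_count_add_largest:
  assumes "a \<le> n"
  shows "gap_count g (add_mset n M) a = gap_count g M a"
  using assms by (simp add: gap_count_def)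

text \<open>
  A letter \<open>b \<ge> h\<close> is an excedance in the columns with \<open>x \<le> b - g\<close>, and the remaining
  columns with \<open>x < b\<close> are those counted by the gap term.
\<close>

lemma bumping_columns:
  assumes g: "1 \<le> g" and le: "\<forall>a\<in>#M. a \<le> n"
  shows "bumping (exceeds g h) fst (gap_count g M) n M (columns M) (Suc (size M), n)"
proof
  fix c :: "nat \<times> nat" and a b :: nat
  show "exceeds g h c a \<Longrightarrow> a \<le> b \<Longrightarrow> exceeds g h c b"
    by (auto simp: exceeds_def)
next
  have "sorted (map snd (columns M @ [(Suc (size M), n)]))"
    using le by (simp add: map_snd_columns sorted_append)
  then have "sorted_wrt (\<lambda>c c'. snd c \<le> snd c') (columns M @ [(Suc (size M), n)])"
    by (simp only: sorted_wrt_map)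
  then show "sorted_wrt (\<lambda>c c'. \<forall>a. exceeds g h c' a \<longrightarrow> exceeds g h c a) (columns M @ [(Suc (size M), n)])"
    by (rule sorted_wrt_mono_rel[rotated]) (auto simp: exceeds_def)
next
  show "a \<le> n \<Longrightarrow> \<not> exceeds g h (Suc (size M), n) a" for a
    using g by (simp add: exceeds_def)
next
  fix c :: "nat \<times> nat" and b :: nat
  assume "exceeds g h c b"
  then have "h \<le> b" by (simp add: exceeds_def)
  then have "length (filter (\<lambda>c. exceeds g h c b) (columns M)) = size {#x \<in># M. x + g \<le> b#}"
    using length_filter_columns[of "\<lambda>x. x + g \<le> b" M] by (simp add: exceeds_def)
  moreover have "{#x \<in># M. x < b#} = {#x \<in># M. x + g \<le> b#} + {#x \<in># M. b < x + g \<and> x < b#}"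
    using g by (induction M) auto
  ultimately show "length (filter (\<lambda>c. exceeds g h c b) (columns M)) + gap_count g M b
      = size {#a \<in># M. a < b#}"
    by (simp add: gap_count_def)
next
  show "y < length (columns M) \<Longrightarrow> fst (columns M ! y) = Suc y" for y
    by (simp add: nth_columns)
qed (use le in auto)

lemma nths_eq_filter:
  assumes "length cs = length w" and "\<And>i. i < length w \<Longrightarrow> i \<in> A \<longleftrightarrow> U (cs ! i) (w ! i)"
  shows "nths w A = map snd (filter (\<lambda>x. U (fst x) (snd x)) (zip cs w))"
  using assms
proof (induction cs w arbitrary: A rule: list_induct2)
  case (Cons c cs a w)
  have "nths w {j. Suc j \<in> A} = map snd (filter (\<lambda>x. U (fst x) (snd x)) (zip cs w))"
    by (rule Cons.IH) (use Cons.prems[of "Suc _"] in auto)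
  then show ?case
    using Cons.prems[of 0] by (simp add: nths_Cons)
qed simp

lemma sum_eq_filter:
  fixes f :: "'a \<Rightarrow> 'b \<Rightarrow> nat"
  assumes "length cs = length w"
  shows "(\<Sum>i | i < length w \<and> U (cs ! i) (w ! i). f (cs ! i) (w ! i))
    = (\<Sum>x\<leftarrow>filter (\<lambda>x. U (fst x) (snd x)) (zip cs w). f (fst x) (snd x))"
proof -
  have "(\<Sum>i | i < length w \<and> U (cs ! i) (w ! i). f (cs ! i) (w ! i))
      = (\<Sum>i\<in>{i \<in> {0..<length w}. U (cs ! i) (w ! i)}. f (cs ! i) (w ! i))"
    by (rule sum.cong) auto
  also have "\<dots> = (\<Sum>i=0..<length w. if U (cs ! i) (w ! i) then f (cs ! i) (w ! i) else 0)"
    by (rule sum.inter_filter) simp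
  also have "\<dots> = (\<Sum>x\<leftarrow>zip cs w. if U (fst x) (snd x) then f (fst x) (snd x) else 0)"
    using assms by (auto simp: sum_list_sum_nth intro!: sum.cong)
  finally show ?thesis by (simp add: sum_list_map_filter')
qed

lemma sort_eq: "mset w = M \<Longrightarrow> sort w = sorted_list_of_multiset M"
  by auto

lemma gExcp_eq:
  assumes "mset w = M"
  shows "gExcp g h w = Suc ` {i. i < length w \<and> exceeds g h (columns M ! i) (w ! i)}"
proof -
  have len: "length w = size M" using assms by (metis size_mset)
  have "i \<in> gExcp g h w \<longleftrightarrow> i \<in> Suc ` {i. i < length w \<and> exceeds g h (columns M ! i) (w ! i)}" for i
    using len
    by (cases i) (auto simp: gExcp_def positions_def letter_def sorted_letter_def sort_eq[OF assms]
        exceeds_def nth_columns image_iff)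
  then show ?thesis by blast
qed

lemma gB_eq:
  assumes "mset w = M"
  shows "gB g w i = gap_count g M (letter w i)"
proof -
  let ?T = "\<lambda>a x. a < x + g \<and> x < a"
  let ?X = "sorted_list_of_multiset M"
  have len: "length w = size M" using assms by (metis size_mset)
  have "{j \<in> positions w. ?T a (sorted_letter w j)} = Suc ` {j. j < length ?X \<and> ?T a (?X ! j)}"
    (is "?A = ?B") for a
  proof (rule set_eqI)
    fix j
    show "j \<in> ?A \<longleftrightarrow> j \<in> ?B"
      using len by (cases j) (auto simp: positions_def letter_def sorted_letter_def sort_eq[OF assms])
  qed
  then have "gB g w i = length (filter (?T (letter w i)) ?X)"
    by (simp only: gB_def card_image inj_Suc length_filter_conv_card)
  also have "\<dots> = gap_count g M (letter w i)"
    unfolding gap_count_def by (metis mset_filter mset_sorted_list_of_multiset size_mset)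
  finally show ?thesis .
qed

lemma gden_eq:
  assumes "mset w = M"
  shows "gden g h w = denert (exceeds g h) fst (gap_count g M) (zip (columns M) w)"
proof -
  have len: "length (columns M) = length w" using assms by (metis length_columns size_mset)
  let ?I = "{i. i < length w \<and> exceeds g h (columns M ! i) (w ! i)}"
  have mem: "Suc i \<in> gExcp g h w \<longleftrightarrow> exceeds g h (columns M ! i) (w ! i)" if "i < length w" for i
    using that by (auto simp: gExcp_eq[OF assms])
  have exc: "gExc g h w = exc_letters (exceeds g h) (zip (columns M) w)"
    unfolding gExc_def subword_def exc_letters_def by (rule nths_eq_filter[OF len]) (simp add: mem)
  have nexc: "gNexc g h w = nexc_letters (exceeds g h) (zip (columns M) w)"
    unfolding gNexc_def subword_def nexc_letters_def
    by (rule nths_eq_filter[OF len, of _ "\<lambda>c a. \<not> exceeds g h c a"]) (simp add: mem)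
  have "(\<Sum>i\<in>gExcp g h w. i + gB g w i)
      = (\<Sum>i\<in>?I. fst (columns M ! i) + gap_count g M (w ! i))"
    unfolding gExcp_eq[OF assms]
    by (subst sum.reindex) (use len in \<open>auto intro!: sum.cong simp: gB_eq[OF assms] letter_def nth_columns\<close>)
  also have "\<dots> = (\<Sum>x\<leftarrow>filter (\<lambda>x. exceeds g h (fst x) (snd x)) (zip (columns M) w).
      fst (fst x) + gap_count g M (snd x))"
    by (rule sum_eq_filter[OF len])
  finally have places: "(\<Sum>i\<in>gExcp g h w. i + gB g w i) = \<dots>" .
  have inv: "word_inv u = related_pairs (>) u" for u
    unfolding word_inv_def by (rule card_related_pairs[of u "\<lambda>a b. b < a"])
  have imv: "word_imv u = related_pairs (\<ge>) u" for u
    unfolding word_imv_def by (rule card_related_pairs[of u "\<lambda>a b. b \<le> a"])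
  show ?thesis
    by (simp only: gden_def denert_def places exc nexc inv imv)
qed

text \<open>
  A letter at least \<open>g\<close> above a column headed by \<open>x \<ge> l\<close> is at least \<open>g + l\<close>, hence at least
  \<open>h\<close>. So the excedances of level \<open>l\<close> are among the excedance places of \<^const>\<open>gden\<close>.
\<close>

lemma gexc_eq:
  assumes "mset w = M" and "h \<le> g + l"
  shows "gexc g l w
    = length (filter (\<lambda>x. exceeds g h (fst x) (snd x) \<and> l \<le> snd (fst x)) (zip (columns M) w))"
proof -
  have len: "length w = size M" using assms by (metis size_mset)
  have "{i \<in> positions w. letter w i \<ge> sorted_letter w i + g \<and> sorted_letter w i \<ge> l}
      = Suc ` {i. i < length (zip (columns M) w) \<and>
          exceeds g h (fst (zip (columns M) w ! i)) (snd (zip (columns M) w ! i))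
          \<and> l \<le> snd (fst (zip (columns M) w ! i))}" (is "?A = ?B")
  proof (rule set_eqI)
    fix i
    show "i \<in> ?A \<longleftrightarrow> i \<in> ?B"
      using len assms(2)
      by (cases i) (auto simp: positions_def letter_def sorted_letter_def sort_eq[OF assms(1)]
          exceeds_def nth_columns)
  qed
  then show ?thesis
    by (simp only: gexc_def card_image inj_Suc length_filter_conv_card)
qed

text \<open>
  Besides the slots that preserve the set of excedance places, the columns below the level
  \<open>l\<close> preserve \<^const>\<open>gexc\<close> too. They form an initial segment, which is the one allowed by
  \<open>slot_label_less_card_iff\<close>.
\<close>

lemma insertion_law_gden:
  assumes g: "1 \<le> g" and h: "h \<le> g + l" and le: "\<forall>a\<in>#M. a \<le> n"
  shows "insertion_law (gexc g l) (gden g h) M n (size {#x \<in># M. \<not> (l \<le> x \<and> x + g \<le> n)#})"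
proof -
  let ?E = "exceeds g h" and ?z = "(Suc (size M), n)"
  interpret bumping ?E fst "gap_count g M" n M "columns M" ?z
    by (rule bumping_columns[OF g le])
  define cells where "cells w = zip (columns M) w" for w :: "nat list"
  define \<phi> where "\<phi> y w = map snd (insert_bump ?E ?z n y (cells w))" for y w
  have len: "length w = size M" if "mset w = M" for w using that by (metis size_mset)
  have len_cells: "length (cells w) = size M" if "mset w = M" for w
    using len[OF that] by (simp add: cells_def)
  have fst_cells: "map fst (cells w) = columns M" and snd_cells: "map snd (cells w) = w"
    if "mset w = M" for w
    using len[OF that] by (simp_all add: cells_def)
  have \<phi>: "mset (\<phi> y w) = add_mset n M" "\<phi> y w ! y = n"
      "zip (columns (add_mset n M)) (\<phi> y w) = insert_bump ?E ?z n y (cells w)"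
    if "mset w = M" "y < Suc (size M)" for y w
  proof -
    have y: "y \<le> length (cells w)" using that len_cells by simp
    show "mset (\<phi> y w) = add_mset n M"
      unfolding \<phi>_def mset_insert_bump[OF y] snd_cells[OF that(1)] that(1) ..
    show "\<phi> y w ! y = n"
      unfolding \<phi>_def by (rule snd_nth_insert_bump[OF y])
    have "columns (add_mset n M) = map fst (insert_bump ?E ?z n y (cells w))"
      by (simp only: map_fst_insert_bump[OF y] fst_cells[OF that(1)] columns_add_largest[OF le])
    then show "zip (columns (add_mset n M)) (\<phi> y w) = insert_bump ?E ?z n y (cells w)"
      by (simp only: \<phi>_def zip_map_fst_snd)
  qed
  show ?thesis
  proof (rule insertion_lawI[where \<phi> = \<phi> and Q = "\<lambda>w. keeps_exc ?E n (cells w)"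
        and low = "\<lambda>y. y < size M \<and> \<not> l \<le> snd (columns M ! y)"])
    fix y assume y: "y < Suc (size M)"
    let ?S = "permutations_of_multiset M"
    let ?T = "{w \<in> permutations_of_multiset (add_mset n M). w ! y = n}"
    have "inj_on (\<phi> y) ?S"
    proof (rule inj_onI)
      fix w w' assume "w \<in> ?S" "w' \<in> ?S" and eq: "\<phi> y w = \<phi> y w'"
      then have w: "mset w = M" "mset w' = M" by (auto simp: permutations_of_multiset_def)
      have "insert_bump ?E ?z n y (cells w) = insert_bump ?E ?z n y (cells w')"
        using \<phi>(3)[OF w(1) y] \<phi>(3)[OF w(2) y] eq by simp
      then have "cells w = cells w'"
        by (rule insert_bump_inj) (use w y fst_cells len_cells in auto)
      then show "w = w'" using snd_cells w by metis
    qed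
    moreover have "\<phi> y ` ?S \<subseteq> ?T"
      using \<phi>(1,2) y by (auto simp: permutations_of_multiset_def)
    \<comment> \<open>plain insertion relates the same two sets, so injectivity is enough for bijectivity\<close>
    moreover have "card ?S = card ?T"
      by (rule bij_betw_same_card[OF bij_betw_insert_letter[OF y]])
    ultimately show "bij_betw (\<phi> y) ?S ?T"
      by (simp add: bij_betw_def card_image card_subset_eq)
  next
    fix w y assume w: "mset w = M" and y: "y < Suc (size M)"
    have y': "y \<le> length (cells w)" using y len_cells[OF w] by simp
    have letters: "mset (map snd (cells w)) = M" by (simp only: snd_cells[OF w] w)
    have le_cells: "snd x \<le> n" if "x \<in> set (cells w)" for x
      by (rule cells_le[OF fst_cells[OF w] letters that])
    have col: "fst (cells w ! y) = columns M ! y" if "y < size M"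
      using that len[OF w] by (simp add: cells_def)
    show "gexc g l (\<phi> y w) = gexc g l w
        + (if keeps_exc ?E n (cells w) y \<or> y < size M \<and> \<not> l \<le> snd (columns M ! y) then 0 else 1)"
      unfolding gexc_eq[OF \<phi>(1)[OF w y] h] gexc_eq[OF w h] \<phi>(3)[OF w y]
      using count_exc_insert_bump[OF y' le_cells, of "\<lambda>c. l \<le> snd c"] len_cells[OF w] col
      by (auto simp: cells_def)
    have "denert ?E fst (gap_count g (add_mset n M)) (insert_bump ?E ?z n y (cells w))
        = denert ?E fst (gap_count g M) (insert_bump ?E ?z n y (cells w))"
    proof -
      have "snd x \<le> n" if "x \<in> set (insert_bump ?E ?z n y (cells w))" for x
      proof -
        have "snd x \<in># mset (\<phi> y w)" using that by (simp add: \<phi>_def)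
        then show ?thesis using le unfolding \<phi>(1)[OF w y] by auto
      qed
      then show ?thesis
        by (auto simp: denert_def gap_count_add_largest intro!: arg_cong[of _ _ sum_list] map_cong)
    qed
    then show "gden g h (\<phi> y w) + count_list (drop (Suc y) (\<phi> y w)) n
        = gden g h w + slot_label (keeps_exc ?E n (cells w)) (Suc (size M)) y"
      using denert_insert_bump[OF fst_cells[OF w] letters y']
      by (simp only: gden_eq[OF \<phi>(1)[OF w y]] gden_eq[OF w] \<phi>(3)[OF w y] len_cells[OF w]
          \<phi>_def[symmetric] cells_def[symmetric])
  next
    fix i j :: nat
    assume "j < i" "i < Suc (size M)" "i < size M \<and> \<not> l \<le> snd (columns M ! i)"
    moreover from this have "sorted_list_of_multiset M ! j \<le> sorted_list_of_multiset M ! i"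
      by (intro sorted_nth_mono) auto
    ultimately show "j < size M \<and> \<not> l \<le> snd (columns M ! j)"
      by (auto simp: nth_columns)
  next
    fix w assume w: "mset w = M"
    let ?low = "\<lambda>c. \<not> l \<le> snd c"
    let ?Q = "\<lambda>x. ?E (fst x) n = ?E (fst x) (snd x) \<or> ?low (fst x)"
    have letters: "mset (map snd (cells w)) = M" by (simp only: snd_cells[OF w] w)
    have le_cells: "snd x \<le> n" if "x \<in> set (cells w)" for x
      by (rule cells_le[OF fst_cells[OF w] letters that])
    have "{y. y < Suc (size M) \<and> (keeps_exc ?E n (cells w) y \<or> y < size M \<and> ?low (columns M ! y))}
        = insert (size M) {y. y < length (cells w) \<and> ?Q (cells w ! y)}"
      using len_cells[OF w] len[OF w] by (auto simp: keeps_exc_def cells_def)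
    then have "card {y. y < Suc (size M) \<and> (keeps_exc ?E n (cells w) y \<or> y < size M \<and> ?low (columns M ! y))}
        = Suc (length (filter ?Q (cells w)))"
      using len_cells[OF w] by (simp add: length_filter_conv_card)
    also have "length (filter ?Q L) = length (filter (\<lambda>x. ?E (fst x) (snd x) \<and> l \<le> snd (fst x)) L)
        + length (filter (\<lambda>x. \<not> (l \<le> snd (fst x) \<and> ?E (fst x) n)) L)"
      if "\<forall>x\<in>set L. snd x \<le> n" for L
      using that by (induction L) (auto dest: E_letter)
    then have "length (filter ?Q (cells w)) = gexc g l w
        + length (filter (\<lambda>x. \<not> (l \<le> snd (fst x) \<and> ?E (fst x) n)) (cells w))"
      using le_cells by (simp add: gexc_eq[OF w h] cells_def)
    also have "length (filter (\<lambda>x. \<not> (l \<le> snd (fst x) \<and> ?E (fst x) n)) (cells w))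
        = length (filter (\<lambda>c. \<not> (l \<le> snd c \<and> ?E c n)) (map fst (cells w)))"
      by (simp add: filter_map comp_def)
    also have "\<dots> = length (filter (\<lambda>c. \<not> (l \<le> snd c \<and> snd c + g \<le> n)) (columns M))"
      unfolding fst_cells[OF w]
      by (intro arg_cong[of _ _ length] filter_cong refl) (use h in \<open>auto simp: exceeds_def\<close>)
    also have "\<dots> = size {#x \<in># M. \<not> (l \<le> x \<and> x + g \<le> n)#}"
      by (rule length_filter_columns)
    finally show "card {y. y < Suc (size M) \<and> (keeps_exc ?E n (cells w) y \<or> y < size M \<and> ?low (columns M ! y))}
        = Suc (gexc g l w + size {#x \<in># M. \<not> (l \<le> x \<and> x + g \<le> n)#})" .
  qed
qed

section \<open>Equidistribution over regular multisets\<close>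

lemma size_filter_regular:
  "size {#x \<in># regular_multiset k m. T x#} = k * card {i \<in> {1..m}. T i}"
proof (induction m)
  case (Suc m)
  have "regular_multiset k (Suc m) = regular_multiset k m + replicate_mset k (Suc m)"
    by (simp add: regular_multiset_def)
  moreover have "{i \<in> {1..Suc m}. T i} = {i \<in> {1..m}. T i} \<union> (if T (Suc m) then {Suc m} else {})"
    by (auto simp: le_Suc_eq)
  moreover have "size {#x \<in># replicate_mset k (Suc m). T x#} = (if T (Suc m) then k else 0)"
    by (induction k) auto
  ultimately show ?case
    using Suc.IH by (simp add: algebra_simps)
qed (simp add: regular_multiset_def)

text \<open>
  This is where the equal multiplicities enter: the letters \<open>x\<close> with \<open>l \<le> x \<le> n - g\<close> are
  the translates by \<open>l - 1\<close> of the letters \<open>a \<le> n - (g + l - 1)\<close>, and the two ranges have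
  the same number of letters because each value occurs \<open>k\<close> times.
\<close>

lemma preserving_letters_eq:
  fixes g l k m j :: nat
  assumes "1 \<le> g" and "1 \<le> l"
  defines "M \<equiv> regular_multiset k m + replicate_mset j (Suc m)"
  shows "size {#a \<in># M. Suc m < a + (g + l - 1)#} = size {#x \<in># M. \<not> (l \<le> x \<and> x + g \<le> Suc m)#}"
proof -
  have split: "size M = size {#x \<in># M. \<not> T x#} + size {#x \<in># M. T x#}" for T
    using multiset_partition[of M "\<lambda>x. \<not> T x"] by (metis (no_types, lifting) filter_mset_cong not_not size_union)
  have new: "{#x \<in># replicate_mset j (Suc m). T x#} = {#}" if "\<not> T (Suc m)" for T
    using that by (induction j) auto
  have "{i \<in> {1..m}. l \<le> i \<and> i + g \<le> Suc m} = (\<lambda>i. i + (l - 1)) ` {i \<in> {1..m}. i + (g + l - 1) \<le> Suc m}"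
    (is "?A = ?f ` ?B")
  proof (rule set_eqI)
    fix i
    show "i \<in> ?A \<longleftrightarrow> i \<in> ?f ` ?B"
    proof
      assume "i \<in> ?A"
      then have "i - (l - 1) \<in> ?B" "i = ?f (i - (l - 1))" using assms(1,2) by auto
      then show "i \<in> ?f ` ?B" by blast
    qed (use assms(1,2) in auto)
  qed
  then have "card ?A = card ?B" by (simp add: card_image)
  then have "size {#x \<in># M. x + (g + l - 1) \<le> Suc m#} = size {#x \<in># M. l \<le> x \<and> x + g \<le> Suc m#}"
    using assms(1,2) by (simp add: M_def size_filter_regular new)
  then show ?thesis
    using split[of "\<lambda>x. x + (g + l - 1) \<le> Suc m"] split[of "\<lambda>x. l \<le> x \<and> x + g \<le> Suc m"]
    by (simp add: not_le)
qed

theorem theorem1p8: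
  fixes k n g l h :: nat
  assumes "k \<ge> 1" and "g \<ge> 1" and "l \<ge> 1" and "1 \<le> h" and "h \<le> g + l"
  shows "r_Euler_Mahonian (g + l - 1) (permutations_of_multiset (regular_multiset k n))
           (gexc g l) (gden g h)"
proof -
  define eqd where "eqd M \<longleftrightarrow>
    (\<Sum>w\<in>permutations_of_multiset M. tq_monom (rdes (g + l - 1) w) (rmaj (g + l - 1) w))
    = (\<Sum>w\<in>permutations_of_multiset M. tq_monom (gexc g l w) (gden g h w))" for M
  have "eqd (regular_multiset k n)"
  proof (induction n)
    case 0
    then show ?case
      by (simp add: eqd_def regular_multiset_def rdes_def rDes_def rmaj_def gexc_def gden_def gExcp_def
          positions_def gExc_def gNexc_def subword_def word_inv_def word_imv_def)
  next
    case (Suc n)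
    have "eqd (regular_multiset k n + replicate_mset j (Suc n))" for j
    proof (induction j)
      case 0
      then show ?case using Suc.IH by simp
    next
      case (Suc j)
      let ?M = "regular_multiset k n + replicate_mset j (Suc n)"
      have le: "\<forall>a\<in>#?M. a \<le> Suc n"
        by (auto simp: regular_multiset_def set_mset_sum)
      have "insertion_law (rdes (g + l - 1)) (rmaj (g + l - 1)) ?M (Suc n)
          (size {#a \<in># ?M. Suc n < a + (g + l - 1)#})"
        by (rule insertion_law_rmaj[OF _ le]) (use assms in simp)
      moreover have "insertion_law (gexc g l) (gden g h) ?M (Suc n)
          (size {#a \<in># ?M. Suc n < a + (g + l - 1)#})"
        unfolding preserving_letters_eq[OF assms(2,3)]
        by (rule insertion_law_gden[OF assms(2,5) le])
      ultimately have "eqd (add_mset (Suc n) ?M)"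
        using Suc.IH unfolding eqd_def by (intro equidistribution_step)
      then show ?case by simp
    qed
    then show ?case by (simp add: regular_multiset_def)
  qed
  then show ?thesis by (simp add: eqd_def r_Euler_Mahonian_def)
qed

end
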